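(* Let $G$ be the graph of a rectangular warehouse with any number $m \ge 1$ of aisles and any number $n \ge 2$ of cross-aisles, together with a pick list (including the depot), such that at least two aisles are non-empty. Then a double edge in the boundary subaisles is not required for a minimal tour; that is, there exists a minimum-length tour subgraph $T \subseteq G$ that contains no double edge in any boundary subaisle.
   Context: **Rectangular warehouse graph.** A rectangular warehouse has $m$ parallel vertical aisles, numbered $1,\dots,m$ from left to right, and $n \ge 2$ parallel horizontal cross-aisles, numbered $1,\dots,n$ from top to bottom. The aisle and cross-aisle crossings give intersection vertices $v_{i,j}$ ($1 \le i \le m$, $1 \le j \le n$). The part of aisle $i$ between the consecutive cross-aisles $j$ and $j+1$ (from $v_{i,j}$ to $v_{i,j+1}$) is called a subaisle. The region between two consecutive cross-aisles is a block, so the warehouse has $n-1$ blocks. Since the layout is rectangular, the distance between aisles $i$ and $i+1$ is a positive number $w_i$ that is the same along every cross-aisle, and the length of the subaisle between cross-aisles $j$ and $j+1$ is a positive number $h_j$ that is the same for every aisle. **Pick locations.** There is a finite set of required pick locations, one of which is the depot. Every pick location other than the depot lies strictly inside a subaisle. The depot may lie strictly inside a subaisle or coincide with an intersection vertex. An aisle is non-empty if it contains at least one pick location (the depot counts as a pick location). **The graph $G$.** The vertices of $G$ are the intersection vertices and the pick locations. Two vertices are adjacent if they are consecutive along an aisle (vertical adjacency) or if they are $v_{i,j}$ and $v_{i+1,j}$ for some $i,j$ (horizontal adjacency). Each adjacent pair is joined by two parallel edges, each of length equal to the distance between the two vertices. **Tour subgraphs.** A tour subgraph is a (multi-)subgraph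 $T \subseteq G$ such that (i) $T$ contains every pick location, including the depot, as a vertex; (ii) $T$ is connected; (iii) every vertex of $T$ has even degree in $T$ (counting parallel edges with multiplicity). The length of $T$ is the sum of the lengths of its edges, counted with multiplicity. A minimum-length tour subgraph (minimal tour) is a tour subgraph of least length. **Double edges.** A double edge of $T$ is a pair of parallel full traversals of one or more consecutive subaisles of the same aisle, with no horizontal edges of $T$ incident to the intermediate intersection vertices; that is, both parallel edges between every pair of consecutive vertices along these subaisles belong to $T$. Thus $T$ contains a double edge in a given subaisle (from $v_{i,j}$ to $v_{i,j+1}$) if and only if, for every two consecutive vertices of $G$ along that subaisle (including the end vertices $v_{i,j}$ and $v_{i,j+1}$), both parallel edges joining them belong to $T$. **Boundary subaisles.** The boundary subaisles are the uppermost and lowermost subaisles of all aisles, i.e. those between cross-aisles $1$ and $2$ and those between cross-aisles $n-1$ and $n$ (these coincide if $n=2$). *)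

theory Defs
  imports Complex_Main
begin

text \<open>
  A vertex is a point \<open>(i, y)\<close>: aisle number \<open>i\<close> together with the distance \<open>y\<close> below
  cross-aisle 1. Aisles are numbered \<open>1..m\<close> from left to right, cross-aisles \<open>1..n\<close> from top
  to bottom. Only the values of \<open>aisle_dist\<close> on \<open>1..<m\<close> and of \<open>subaisle_length\<close> on \<open>1..<n\<close>
  are meaningful.
\<close>

type_synonym point = "nat \<times> real"

record warehouse =
  num_aisles :: nat
  num_cross :: nat
  aisle_dist :: "nat \<Rightarrow> real"
  subaisle_length :: "nat \<Rightarrow> real"
  picks :: "point set"
  depot :: point

definition cross_pos :: "warehouse \<Rightarrow> nat \<Rightarrow> real" where
  "cross_pos W j = (\<Sum>k\<in>{1..<j}. subaisle_length W k)"

definition crossing :: "warehouse \<Rightarrow> nat \<Rightarrow> nat \<Rightarrow> point" where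
  "crossing W i j = (i, cross_pos W j)"

definition intersections :: "warehouse \<Rightarrow> point set" where
  "intersections W = {crossing W i j | i j. i \<in> {1..num_aisles W} \<and> j \<in> {1..num_cross W}}"

definition subaisle_interiors :: "warehouse \<Rightarrow> point set" where
  "subaisle_interiors W =
     {(i, y) | i j y. i \<in> {1..num_aisles W} \<and> j \<in> {1..<num_cross W} \<and>
                      cross_pos W j < y \<and> y < cross_pos W (j + 1)}"

definition rectangular_warehouse :: "warehouse \<Rightarrow> bool" where
  "rectangular_warehouse W \<longleftrightarrow>
     num_aisles W \<ge> 1 \<and> num_cross W \<ge> 2 \<and>
     (\<forall>i\<in>{1..<num_aisles W}. aisle_dist W i > 0) \<and>
     (\<forall>j\<in>{1..<num_cross W}. subaisle_length W j > 0) \<and>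
     finite (picks W) \<and> depot W \<in> picks W \<and>
     picks W - {depot W} \<subseteq> subaisle_interiors W \<and>
     depot W \<in> subaisle_interiors W \<union> intersections W"

definition nonempty_aisles :: "warehouse \<Rightarrow> nat set" where
  "nonempty_aisles W = {i \<in> {1..num_aisles W}. \<exists>p\<in>picks W. fst p = i}"

definition vertices :: "warehouse \<Rightarrow> point set" where
  "vertices W = intersections W \<union> picks W"

text \<open>
  Both adjacency relations are oriented (upper to lower vertex, left to right vertex), so that
  every adjacent pair is listed exactly once.
\<close>

definition vertical_adj :: "warehouse \<Rightarrow> point \<Rightarrow> point \<Rightarrow> bool" where
  "vertical_adj W u v \<longleftrightarrow>
     u \<in> vertices W \<and> v \<in> vertices W \<and> fst u = fst v \<and> snd u < snd v \<and>
     \<not> (\<exists>x\<in>vertices W. fst x = fst u \<and> snd u < snd x \<and> snd x < snd v)"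

definition horizontal_adj :: "warehouse \<Rightarrow> point \<Rightarrow> point \<Rightarrow> bool" where
  "horizontal_adj W u v \<longleftrightarrow>
     (\<exists>i\<in>{1..<num_aisles W}. \<exists>j\<in>{1..num_cross W}. u = crossing W i j \<and> v = crossing W (i + 1) j)"

text \<open>
  Edges are undirected. The Boolean component distinguishes the two parallel edges joining an
  adjacent pair.
\<close>

type_synonym edge = "point \<times> point \<times> bool"

definition graph_edges :: "warehouse \<Rightarrow> edge set" where
  "graph_edges W = {(u, v, c) | u v c. vertical_adj W u v \<or> horizontal_adj W u v}"

fun edge_length :: "warehouse \<Rightarrow> edge \<Rightarrow> real" where
  "edge_length W (u, v, c) = (if fst u = fst v then snd v - snd u else aisle_dist W (fst u))"

fun edge_ends :: "edge \<Rightarrow> point set" where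
  "edge_ends (u, v, c) = {u, v}"

record multigraph =
  verts :: "point set"
  edges :: "edge set"

definition subgraph_of :: "multigraph \<Rightarrow> warehouse \<Rightarrow> bool" where
  "subgraph_of T W \<longleftrightarrow>
     verts T \<subseteq> vertices W \<and> edges T \<subseteq> graph_edges W \<and> (\<forall>e\<in>edges T. edge_ends e \<subseteq> verts T)"

definition connected_graph :: "multigraph \<Rightarrow> bool" where
  "connected_graph T \<longleftrightarrow>
     (\<forall>u\<in>verts T. \<forall>v\<in>verts T. (u, v) \<in> {(x, y). \<exists>e\<in>edges T. edge_ends e = {x, y}}\<^sup>*)"

definition degree :: "multigraph \<Rightarrow> point \<Rightarrow> nat" where
  "degree T x = card {e \<in> edges T. x \<in> edge_ends e}"

definition tour_subgraph :: "warehouse \<Rightarrow> multigraph \<Rightarrow> bool" where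
  "tour_subgraph W T \<longleftrightarrow>
     subgraph_of T W \<and> picks W \<subseteq> verts T \<and> connected_graph T \<and>
     (\<forall>x\<in>verts T. even (degree T x))"

definition tour_length :: "warehouse \<Rightarrow> multigraph \<Rightarrow> real" where
  "tour_length W T = (\<Sum>e\<in>edges T. edge_length W e)"

definition minimal_tour :: "warehouse \<Rightarrow> multigraph \<Rightarrow> bool" where
  "minimal_tour W T \<longleftrightarrow>
     tour_subgraph W T \<and> (\<forall>T'. tour_subgraph W T' \<longrightarrow> tour_length W T \<le> tour_length W T')"

text \<open>\<open>T\<close> contains a double edge in the subaisle of aisle \<open>i\<close> between cross-aisles \<open>j\<close> and \<open>j + 1\<close>.\<close>

definition double_edge_in :: "warehouse \<Rightarrow> multigraph \<Rightarrow> nat \<Rightarrow> nat \<Rightarrow> bool" where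
  "double_edge_in W T i j \<longleftrightarrow>
     (\<forall>u v. vertical_adj W u v \<and> fst u = i \<and>
            cross_pos W j \<le> snd u \<and> snd v \<le> cross_pos W (j + 1) \<longrightarrow>
            (\<forall>c. (u, v, c) \<in> edges T))"

definition boundary_subaisles :: "warehouse \<Rightarrow> (nat \<times> nat) set" where
  "boundary_subaisles W = {1..num_aisles W} \<times> {1, num_cross W - 1}"

end

theory Submission imports Defs begin

text \<open>
  Only how often each pair of adjacent vertices is joined matters for a tour subgraph, so tours are
  studied as multiplicity functions \<open>f\<close> with values 0, 1, 2 on the adjacent pairs (links). Among
  the functions of least length choose one with the fewest doubled boundary subaisles; call it
  optimal. It turns out to have no doubled boundary subaisle at all.

  The tool is the rectangle swap. Let \<open>i\<close> and \<open>i'\<close> be neighbouring aisles and let aisle \<open>i\<close> be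
  doubled from cross-aisle \<open>a\<close> to cross-aisle \<open>b\<close>, with some copy of the rung (horizontal link)
  between \<open>i\<close> and \<open>i'\<close> present at level \<open>a\<close>. Remove one copy of each link of aisle \<open>i\<close> between the
  two levels and one copy of the rung at \<open>a\<close>; add one copy of the rung at \<open>b\<close> and of each link of
  aisle \<open>i'\<close> between the levels, where adding to a doubled link means going down to one copy.
  Every degree changes by an even number. Opposite sides of the rectangle are equally long, so the
  tour does not get longer. It stays connected, because the other three sides of the rectangle
  still join the ends of the rung at \<open>a\<close>. The doubled subaisle of aisle \<open>i\<close> has become single, so
  in an optimal function the swap must double the corresponding subaisle of aisle \<open>i'\<close>, and the
  result is optimal again (\<open>swap_optimal\<close>).

  Let \<open>f\<close> be optimal with a doubled boundary subaisle in aisle \<open>i\<close>, and let \<open>e\<close> be the extreme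
  cross-aisle (top or bottom) at its outer end. Then the crossing \<open>v\<close> of aisle \<open>i\<close> and
  cross-aisle \<open>e\<close> is the depot and has no rungs (\<open>double_end_is_depot\<close>):

  \<^item> No rung at \<open>v\<close> is doubled. Otherwise the swap would leave a copy of it, so the newly doubled
    subaisle would have both ends joined around the rectangle, and one of its doubled links could
    be deleted.
  \<^item> If \<open>v\<close> is not the depot, it has a rung. Otherwise \<open>v\<close> would be a dead end without a pick, and
    could be pruned.
  \<^item> A rung at \<open>v\<close> is thus single, and by parity there is a single rung on both sides. Swap towards
    a side whose crossing at level \<open>e\<close> is not the depot. After the swap that crossing also ends a
    doubled boundary subaisle, and the rung back to aisle \<open>i\<close> is gone. So it has at most one rung,
    which is not single by parity, not double by the first item, and not missing by the second.

  Finally let \<open>j0\<close> be the level nearest to \<open>e\<close> at which aisle \<open>i\<close> has a rung; it exists since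
  another aisle contains a pick. For each link of aisle \<open>i\<close> between \<open>e\<close> and \<open>j0\<close>, the part of
  the aisle from \<open>e\<close> up to that link is attached to the rest by that link only, which is therefore
  doubled. The level \<open>j0\<close> is not the opposite extreme one:
  there a doubled boundary subaisle would end too, and the depot would be at both crossings.
  A swap with \<open>a = j0\<close> and \<open>b = e\<close> gives an optimal function with a doubled boundary subaisle that
  ends at level \<open>e\<close> of the neighbouring aisle. So the crossing there is the depot as well, which is
  absurd.
\<close>

section \<open>Vertices and links\<close>

text \<open>
  Quantified points and links are kept as single variables: splitting them into coordinates hides
  the facts about links from the simplifier.
\<close>
declare split_paired_All [simp del] split_paired_Ex [simp del]

type_synonym link = "point \<times> point"

locale warehouse_graph =
  fixes W :: warehouse
  assumes rect: "rectangular_warehouse W"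
begin

abbreviation "m \<equiv> num_aisles W"
abbreviation "n \<equiv> num_cross W"
abbreviation "cp \<equiv> cross_pos W"
abbreviation "cr \<equiv> crossing W"

definition links :: "link set" where
  "links = {(u, v). vertical_adj W u v \<or> horizontal_adj W u v}"

definition link_length :: "link \<Rightarrow> real" where
  "link_length p = edge_length W (fst p, snd p, True)"

definition aisle_part :: "nat \<Rightarrow> real \<Rightarrow> real \<Rightarrow> link set" where
  "aisle_part i y z = {(u, v). vertical_adj W u v \<and> fst u = i \<and> y \<le> snd u \<and> snd v \<le> z}"

text \<open>
  The order of the two levels is irrelevant, so that statements about the top and the bottom of the
  warehouse can share one proof.
\<close>
definition segment :: "nat \<Rightarrow> nat \<Rightarrow> nat \<Rightarrow> link set" where
  "segment i a b = aisle_part i (min (cp a) (cp b)) (max (cp a) (cp b))"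

definition rung :: "nat \<Rightarrow> nat \<Rightarrow> nat \<Rightarrow> link" where
  "rung i i' j = (cr (min i i') j, cr (max i i') j)"

lemma n_ge: "n \<ge> 2"
  using rect by (auto simp: rectangular_warehouse_def)

lemma cp_Suc: "j \<ge> 1 \<Longrightarrow> cp (Suc j) = cp j + subaisle_length W j"
  unfolding cross_pos_def by (simp add: atLeastLessThanSuc)

lemma cp_less: assumes "1 \<le> a" "a < b" "b \<le> n" shows "cp a < cp b"
  using assms(2,3)
proof (induction b)
  case (Suc b)
  have "subaisle_length W b > 0" using rect Suc assms(1) by (auto simp: rectangular_warehouse_def)
  moreover have "cp (Suc b) = cp b + subaisle_length W b" using cp_Suc Suc assms(1) by simp
  ultimately show ?case using Suc by (cases "a = b") auto
qed simp

lemma cp_le: "1 \<le> a \<Longrightarrow> a \<le> b \<Longrightarrow> b \<le> n \<Longrightarrow> cp a \<le> cp b"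
  using cp_less[of a b] by (cases "a = b") auto

lemma cp_less_iff: "a \<in> {1..n} \<Longrightarrow> b \<in> {1..n} \<Longrightarrow> cp a < cp b \<longleftrightarrow> a < b"
  by (metis atLeastAtMost_iff cp_less cp_le not_less)

lemma cp_le_iff: "a \<in> {1..n} \<Longrightarrow> b \<in> {1..n} \<Longrightarrow> cp a \<le> cp b \<longleftrightarrow> a \<le> b"
  using cp_less_iff by (metis not_less)

lemma cp_eq_iff: "a \<in> {1..n} \<Longrightarrow> b \<in> {1..n} \<Longrightarrow> cp a = cp b \<longleftrightarrow> a = b"
  using cp_le_iff by (metis order.eq_iff)

lemma fst_cr [simp]: "fst (cr i j) = i" and snd_cr [simp]: "snd (cr i j) = cp j"
  by (auto simp: crossing_def)

lemma cr_eq_iff: "a \<in> {1..n} \<Longrightarrow> b \<in> {1..n} \<Longrightarrow> cr i a = cr i' b \<longleftrightarrow> i = i' \<and> a = b"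
  by (auto simp: crossing_def cp_eq_iff)

lemma cr_in_vertices: "i \<in> {1..m} \<Longrightarrow> j \<in> {1..n} \<Longrightarrow> cr i j \<in> vertices W"
  by (auto simp: vertices_def intersections_def)

lemma vertex_bounds:
  assumes "x \<in> vertices W"
  shows "fst x \<in> {1..m}" "cp 1 \<le> snd x" "snd x \<le> cp n"
proof -
  have "x \<in> intersections W \<or> x \<in> subaisle_interiors W"
    using assms rect by (auto simp: vertices_def rectangular_warehouse_def)
  then have "fst x \<in> {1..m} \<and> cp 1 \<le> snd x \<and> snd x \<le> cp n"
  proof
    assume "x \<in> intersections W"
    then show ?thesis using cp_le by (auto simp: intersections_def)
  next
    assume "x \<in> subaisle_interiors W"
    then obtain i j y where x: "x = (i, y)" "i \<in> {1..m}" "j \<in> {1..<n}" "cp j < y" "y < cp (j+1)"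
      by (auto simp: subaisle_interiors_def)
    then have "cp 1 \<le> cp j" "cp (j+1) \<le> cp n" using cp_le[of 1 j] cp_le[of "j+1" n] by auto
    with x show ?thesis by auto
  qed
  then show "fst x \<in> {1..m}" "cp 1 \<le> snd x" "snd x \<le> cp n" by auto
qed

lemma finite_vertices: "finite (vertices W)"
proof -
  have "intersections W = (\<lambda>(i, j). cr i j) ` ({1..m} \<times> {1..n})"
    unfolding intersections_def by (rule set_eqI) force
  then have "finite (intersections W)" by simp
  then show ?thesis using rect by (simp add: vertices_def rectangular_warehouse_def)
qed

lemma link_vertices: "(u, v) \<in> links \<Longrightarrow> u \<in> vertices W \<and> v \<in> vertices W"
  by (auto simp: links_def vertical_adj_def horizontal_adj_def intro!: cr_in_vertices)

lemma finite_links: "finite links"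
proof (rule finite_subset)
  show "links \<subseteq> vertices W \<times> vertices W" using link_vertices by auto
qed (simp add: finite_vertices)

lemma link_length_pos: "p \<in> links \<Longrightarrow> link_length p > 0"
  using rect by (cases p)
    (auto simp: links_def link_length_def vertical_adj_def horizontal_adj_def
      rectangular_warehouse_def crossing_def)

lemma link_ends_distinct: "p \<in> links \<Longrightarrow> fst p \<noteq> snd p"
  by (cases p) (auto simp: links_def vertical_adj_def horizontal_adj_def crossing_def)

lemma pred_vertex:
  assumes "(i, y) \<in> vertices W" "(i, z) \<in> vertices W" "y < z"
  obtains x where "y \<le> x" "x < z" "vertical_adj W (i, x) (i, z)"
proof -
  let ?A = "{x. (i, x) \<in> vertices W \<and> x < z}"
  have fin: "finite ?A"
    by (rule finite_subset[OF _ finite_imageI[OF finite_vertices, of snd]]) force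
  have y: "y \<in> ?A" using assms by auto
  have mx: "Max ?A \<in> ?A" using fin y by (intro Max_in) auto
  have le: "x \<le> Max ?A" if "x \<in> ?A" for x using fin that by (rule Max_ge)
  have "vertical_adj W (i, Max ?A) (i, z)"
    unfolding vertical_adj_def using mx assms le by force
  moreover have "y \<le> Max ?A" "Max ?A < z" using le[OF y] mx by auto
  ultimately show ?thesis using that by blast
qed

lemma succ_vertex:
  assumes "(i, y) \<in> vertices W" "(i, z) \<in> vertices W" "y < z"
  obtains x where "y < x" "x \<le> z" "vertical_adj W (i, y) (i, x)"
proof -
  let ?A = "{x. (i, x) \<in> vertices W \<and> y < x}"
  have fin: "finite ?A"
    by (rule finite_subset[OF _ finite_imageI[OF finite_vertices, of snd]]) force
  have z: "z \<in> ?A" using assms by auto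
  have mx: "Min ?A \<in> ?A" using fin z by (intro Min_in) auto
  have le: "Min ?A \<le> x" if "x \<in> ?A" for x using fin that by (rule Min_le)
  have "vertical_adj W (i, y) (i, Min ?A)"
    unfolding vertical_adj_def using mx assms le by force
  moreover have "Min ?A \<le> z" "y < Min ?A" using le[OF z] mx by auto
  ultimately show ?thesis using that by blast
qed

lemma aisle_part_links: "aisle_part i y z \<subseteq> links"
  by (auto simp: aisle_part_def links_def)

lemma aisle_part_insert:
  assumes "vertical_adj W (i, x) (i, z)" "y \<le> x"
  shows "aisle_part i y z = insert ((i, x), (i, z)) (aisle_part i y x)"
    and "((i, x), (i, z)) \<notin> aisle_part i y x"
proof -
  show "((i, x), (i, z)) \<notin> aisle_part i y x"
    using assms by (auto simp: aisle_part_def vertical_adj_def)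
  show "aisle_part i y z = insert ((i, x), (i, z)) (aisle_part i y x)"
  proof (rule set_eqI, clarify)
    fix i1 y1 i2 y2
    have "y2 \<le> x \<or> (y1 = x \<and> y2 = z)"
      if "vertical_adj W (i, y1) (i, y2)" "y2 \<le> z"
    proof (rule ccontr)
      assume *: "\<not> ?thesis"
      have 1: "(i, x) \<in> vertices W" "(i, y2) \<in> vertices W" "y1 < y2" "(i,y1) \<in> vertices W"
        "(i,z) \<in> vertices W"
        using that assms by (auto simp: vertical_adj_def)
      have "x < y2" using * by auto
      have "\<not> y1 < x" using that(1) 1 \<open>x < y2\<close> by (auto simp: vertical_adj_def)
      moreover have "\<not> x < y1" using assms(1) 1 that(2) by (force simp: vertical_adj_def)
      moreover have "\<not> y2 < z" using assms(1) 1 \<open>x < y2\<close> by (force simp: vertical_adj_def)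
      ultimately show False using * that by auto
    qed
    then show "((i1, y1), (i2, y2)) \<in> aisle_part i y z \<longleftrightarrow>
        ((i1, y1), (i2, y2)) \<in> insert ((i, x), (i, z)) (aisle_part i y x)"
      using assms by (auto simp: aisle_part_def vertical_adj_def)
  qed
qed

lemma aisle_part_refl: "aisle_part i y y = {}"
  by (auto simp: aisle_part_def vertical_adj_def)

text \<open>
  Induction from the upper end of an aisle part downwards, one link at a time. It yields the
  length, the parity and the connectedness of aisle parts.
\<close>
lemma aisle_part_induct:
  assumes "(i, y) \<in> vertices W" "(i, z) \<in> vertices W" "y \<le> z"
    and base: "P y {}"
    and step: "\<And>x z. vertical_adj W (i, x) (i, z) \<Longrightarrow> y \<le> x \<Longrightarrow>
      ((i, x), (i, z)) \<notin> aisle_part i y x \<Longrightarrow> P x (aisle_part i y x) \<Longrightarrow>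
      P z (insert ((i, x), (i, z)) (aisle_part i y x))"
  shows "P z (aisle_part i y z)"
  using assms(2,3)
proof (induction "card {x. (i, x) \<in> vertices W \<and> y \<le> x \<and> x < z}" arbitrary: z rule: less_induct)
  case less
  show ?case
  proof (cases "y = z")
    case True
    then show ?thesis using base by (simp add: aisle_part_refl)
  next
    case False
    then have "y < z" using less by auto
    then obtain x where x: "y \<le> x" "x < z" "vertical_adj W (i, x) (i, z)"
      using pred_vertex assms(1) less by metis
    let ?A = "\<lambda>z. {x. (i, x) \<in> vertices W \<and> y \<le> x \<and> x < z}"
    have fin: "finite (?A z)"
      by (rule finite_subset[OF _ finite_imageI[OF finite_vertices, of snd]]) force
    have xv: "(i, x) \<in> vertices W" using x by (auto simp: vertical_adj_def)
    then have "?A x \<subset> ?A z" using x by auto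
    then have "card (?A x) < card (?A z)" using fin psubset_card_mono by blast
    then have "P x (aisle_part i y x)" using less(1) xv x by blast
    then show ?thesis using step aisle_part_insert x by metis
  qed
qed

lemma aisle_part_length:
  assumes "(i, y) \<in> vertices W" "(i, z) \<in> vertices W" "y \<le> z"
  shows "(\<Sum>p\<in>aisle_part i y z. link_length p) = z - y"
proof (rule aisle_part_induct[OF assms, where P = "\<lambda>z A. sum link_length A = z - y"])
  fix x z
  assume "((i, x), (i, z)) \<notin> aisle_part i y x" "sum link_length (aisle_part i y x) = x - y"
  then show "sum link_length (insert ((i, x), i, z) (aisle_part i y x)) = z - y"
    using finite_subset[OF aisle_part_links finite_links]
    by (simp add: link_length_def)
qed simp

section \<open>Aisle parts: parity and connection\<close>

text \<open>
  Written as a sum, so that degrees are sums over links and can be exchanged with sums over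
  vertices.
\<close>
definition ends_at :: "point \<Rightarrow> link \<Rightarrow> nat" where
  "ends_at x p = of_bool (fst p = x) + of_bool (snd p = x)"

text \<open>
  A path meets each of its inner vertices twice and each end once.
\<close>
lemma aisle_part_parity:
  assumes "(i, y) \<in> vertices W" "(i, z) \<in> vertices W" "y \<le> z"
  shows "even ((\<Sum>p\<in>aisle_part i y z. ends_at x p) + of_bool (x = (i, y)) + of_bool (x = (i, z)))"
proof (rule aisle_part_induct[OF assms, where
      P = "\<lambda>z A. even (sum (ends_at x) A + of_bool (x = (i, y)) + of_bool (x = (i, z)))"])
  fix x' z
  assume "((i, x'), (i, z)) \<notin> aisle_part i y x'"
    "even (sum (ends_at x) (aisle_part i y x') + of_bool (x = (i, y)) + of_bool (x = (i, x')))"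
  then show "even (sum (ends_at x) (insert ((i, x'), i, z) (aisle_part i y x'))
      + of_bool (x = (i, y)) + of_bool (x = (i, z)))"
    using finite_subset[OF aisle_part_links finite_links]
    by (auto simp: ends_at_def)
qed simp

definition conn :: "(link \<Rightarrow> nat) \<Rightarrow> link set" where
  "conn f = ({p. f p \<noteq> 0} \<union> {p. f p \<noteq> 0}\<inverse>)\<^sup>*"

lemma conn_refl [simp]: "(x, x) \<in> conn f"
  by (simp add: conn_def)

lemma conn_sym: "(x, y) \<in> conn f \<Longrightarrow> (y, x) \<in> conn f"
  unfolding conn_def by (rule symD[OF sym_rtrancl]) (auto simp: sym_def)

lemma conn_trans: "(x, y) \<in> conn f \<Longrightarrow> (y, z) \<in> conn f \<Longrightarrow> (x, z) \<in> conn f"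
  unfolding conn_def by (rule rtrancl_trans)

lemma conn_link: "f (x, y) \<noteq> 0 \<Longrightarrow> (x, y) \<in> conn f"
  unfolding conn_def by auto

text \<open>
  Connectivity survives any map of the vertices that sends links to connected pairs. The identity
  serves when links are replaced by detours, a retraction when a dead end is pruned.
\<close>
lemma conn_map:
  assumes "(s, t) \<in> conn f" and "\<And>x y. f (x, y) \<noteq> 0 \<Longrightarrow> (h x, h y) \<in> conn g"
  shows "(h s, h t) \<in> conn g"
  using assms(1) unfolding conn_def[of f]
proof (induction rule: rtrancl_induct)
  case (step y z)
  then have "(h y, h z) \<in> conn g" using assms(2) conn_sym by blast
  with step show ?case using conn_trans by blast
qed simp

lemma aisle_part_conn:
  assumes "(i, y) \<in> vertices W" "(i, z) \<in> vertices W" "y \<le> z"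
    and "\<And>p. p \<in> aisle_part i y z \<Longrightarrow> f p \<noteq> 0"
  shows "((i, y), (i, z)) \<in> conn f"
    and "(u, v) \<in> aisle_part i y z \<Longrightarrow> ((i, y), u) \<in> conn f \<and> ((i, y), v) \<in> conn f"
proof -
  have "(\<forall>p\<in>aisle_part i y z. f p \<noteq> 0) \<longrightarrow>
      ((i, y), (i, z)) \<in> conn f \<and>
      (\<forall>u v. (u, v) \<in> aisle_part i y z \<longrightarrow> ((i, y), u) \<in> conn f \<and> ((i, y), v) \<in> conn f)"
    by (rule aisle_part_induct[OF assms(1-3), where P = "\<lambda>z A. (\<forall>p\<in>A. f p \<noteq> 0) \<longrightarrow>
      ((i, y), (i, z)) \<in> conn f \<and>
      (\<forall>u v. (u, v) \<in> A \<longrightarrow> ((i, y), u) \<in> conn f \<and> ((i, y), v) \<in> conn f)"])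
      (auto intro: conn_trans conn_link)
  then show "((i, y), (i, z)) \<in> conn f"
    and "(u, v) \<in> aisle_part i y z \<Longrightarrow> ((i, y), u) \<in> conn f \<and> ((i, y), v) \<in> conn f"
    using assms(4) by blast+
qed

section \<open>Tours as multiplicity functions\<close>

definition deg :: "(link \<Rightarrow> nat) \<Rightarrow> point \<Rightarrow> nat" where
  "deg f x = (\<Sum>p\<in>links. f p * ends_at x p)"

definition mult_length :: "(link \<Rightarrow> nat) \<Rightarrow> real" where
  "mult_length f = (\<Sum>p\<in>links. real (f p) * link_length p)"

text \<open>
  The vertex set of the tour is left implicit: it consists of the picks and of the ends of the
  links in use. Connectivity is stated from the depot, since connection is an equivalence relation.
\<close>
definition tour_mult :: "(link \<Rightarrow> nat) \<Rightarrow> bool" where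
  "tour_mult f \<longleftrightarrow> (\<forall>p. f p \<le> 2) \<and> (\<forall>p. f p \<noteq> 0 \<longrightarrow> p \<in> links) \<and> (\<forall>x. even (deg f x)) \<and>
     (\<forall>x \<in> picks W \<union> Field {p. f p \<noteq> 0}. (depot W, x) \<in> conn f)"

lemma tour_multD:
  assumes "tour_mult f"
  shows "f p \<le> 2" and "f p \<noteq> 0 \<Longrightarrow> p \<in> links" and "even (deg f x)"
    and "x \<in> picks W \<union> Field {p. f p \<noteq> 0} \<Longrightarrow> (depot W, x) \<in> conn f"
  using assms unfolding tour_mult_def by blast+

definition mult :: "multigraph \<Rightarrow> link \<Rightarrow> nat" where
  "mult T p = card {c. (fst p, snd p, c) \<in> edges T}"

text \<open>
  A link of multiplicity 1 is represented by its copy \<open>True\<close>.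
\<close>
definition graph_of :: "(link \<Rightarrow> nat) \<Rightarrow> multigraph" where
  "graph_of f = \<lparr>verts = picks W \<union> Field {p. f p \<noteq> 0},
     edges = {(u, v, c). (if c then 1 else 2) \<le> f (u, v)}\<rparr>"

lemma card_bool_set: "card {c::bool. P c} = of_bool (P True) + of_bool (P False)"
proof -
  have "{c. P c} = {c. c \<and> P True} \<union> {c. \<not> c \<and> P False}"
    by (auto, (metis (full_types))+)
  also have "card \<dots> = card {c. c \<and> P True} + card {c. \<not> c \<and> P False}"
    by (intro card_Un_disjoint) auto
  also have "{c. c \<and> P True} = (if P True then {True} else {})" by auto
  also have "{c. \<not> c \<and> P False} = (if P False then {False} else {})" by auto
  finally show ?thesis by auto
qed

lemma mult_graph_of: assumes "tour_mult f" shows "mult (graph_of f) = f"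
proof
  fix p
  have "f p \<le> 2" using assms by (rule tour_multD)
  then show "mult (graph_of f) p = f p"
    by (auto simp: mult_def graph_of_def card_bool_set)
qed

lemma sum_edges:
  fixes g :: "link \<Rightarrow> real"
  assumes "edges T \<subseteq> graph_edges W"
  shows "(\<Sum>(u, v, c)\<in>edges T. g (u, v)) = (\<Sum>p\<in>links. real (mult T p) * g p)"
proof -
  let ?E = "SIGMA p:links. {c. (fst p, snd p, c) \<in> edges T}"
  have b: "bij_betw (\<lambda>(p, c). (fst p, snd p, c)) ?E (edges T)"
    using assms by (auto simp: bij_betw_def inj_on_def graph_edges_def links_def image_iff split_paired_Ex)
  have "(\<Sum>(u, v, c)\<in>edges T. g (u, v)) = (\<Sum>(p, c)\<in>?E. g p)"
    by (subst sum.reindex_bij_betw[OF b, symmetric]) (auto intro!: sum.cong)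
  also have "\<dots> = (\<Sum>p\<in>links. real (mult T p) * g p)"
    by (subst sum.Sigma[symmetric]) (auto simp: finite_links mult_def)
  finally show ?thesis .
qed

lemma tour_length_mult:
  assumes "edges T \<subseteq> graph_edges W" shows "tour_length W T = mult_length (mult T)"
proof -
  have "tour_length W T = (\<Sum>(u, v, c)\<in>edges T. link_length (u, v))"
    unfolding tour_length_def by (intro sum.cong) (auto simp: link_length_def)
  then show ?thesis using sum_edges[OF assms] by (simp add: mult_length_def)
qed

lemma degree_mult:
  assumes "edges T \<subseteq> graph_edges W" shows "degree T x = deg (mult T) x"
proof -
  have fin: "finite (edges T)"
  proof (rule finite_subset)
    show "edges T \<subseteq> (\<lambda>(p, c). (fst p, snd p, c)) ` (links \<times> UNIV)"
      using assms by (auto simp: graph_edges_def links_def image_iff split_paired_Ex)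
  qed (simp add: finite_links)
  have "real (degree T x) = (\<Sum>e\<in>edges T. of_bool (x \<in> edge_ends e))"
    unfolding degree_def using fin by (simp add: Int_def)
  also have "\<dots> = (\<Sum>(u, v, c)\<in>edges T. real (ends_at x (u, v)))"
  proof (intro sum.cong refl, clarify)
    fix u1 u2 v1 v2 and c :: bool
    assume "((u1, u2), (v1, v2), c) \<in> edges T"
    then have "(u1, u2) \<noteq> (v1, v2)"
      using assms link_ends_distinct[of "((u1, u2), (v1, v2))"]
      by (auto simp: graph_edges_def links_def)
    then show "(of_bool (x \<in> edge_ends ((u1, u2), (v1, v2), c)) :: real) =
        real (ends_at x ((u1, u2), (v1, v2)))"
      by (auto simp: ends_at_def)
  qed
  also have "\<dots> = real (deg (mult T) x)"
    using sum_edges[OF assms, of "\<lambda>p. real (ends_at x p)"] by (simp add: deg_def)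
  finally show ?thesis by simp
qed

lemma mult_nonzero: "mult T (u, v) \<noteq> 0 \<longleftrightarrow> (\<exists>c. (u, v, c) \<in> edges T)"
  by (auto simp: mult_def card_bool_set) (metis (full_types))

lemma conn_mult: "conn (mult T) = {(x, y). \<exists>e\<in>edges T. edge_ends e = {x, y}}\<^sup>*"
proof -
  have "{p. mult T p \<noteq> 0} \<union> {p. mult T p \<noteq> 0}\<inverse> = {(x, y). \<exists>e\<in>edges T. edge_ends e = {x, y}}"
  proof (rule set_eqI, clarify)
    fix x1 y1 :: nat and x2 y2 :: real
    let ?x = "(x1, x2)" and ?y = "(y1, y2)"
    show "((?x, ?y) \<in> {p. mult T p \<noteq> 0} \<union> {p. mult T p \<noteq> 0}\<inverse> \<longleftrightarrow>
        (?x, ?y) \<in> {(x, y). \<exists>e\<in>edges T. edge_ends e = {x, y}})"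
      unfolding Un_iff mem_Collect_eq converse_iff prod.case mult_nonzero
    proof
      assume "(\<exists>c. (?x, ?y, c) \<in> edges T) \<or> (\<exists>c. (?y, ?x, c) \<in> edges T)"
      then show "\<exists>e\<in>edges T. edge_ends e = {?x, ?y}"
        by (elim disjE exE) (force intro: bexI)+
    next
      assume "\<exists>e\<in>edges T. edge_ends e = {?x, ?y}"
      then obtain u v c where "(u, v, c) \<in> edges T" "{u, v} = {?x, ?y}" by auto
      then show "(\<exists>c. (?x, ?y, c) \<in> edges T) \<or> (\<exists>c. (?y, ?x, c) \<in> edges T)"
        by (auto simp: doubleton_eq_iff)
    qed
  qed
  then show ?thesis by (simp add: conn_def)
qed

lemma tour_mult_of_tour:
  assumes "tour_subgraph W T" shows "tour_mult (mult T)"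
proof -
  have sub: "edges T \<subseteq> graph_edges W" and en: "\<And>e. e \<in> edges T \<Longrightarrow> edge_ends e \<subseteq> verts T"
    and pv: "picks W \<subseteq> verts T" and con: "connected_graph T"
    and ev: "\<And>x. x \<in> verts T \<Longrightarrow> even (degree T x)"
    using assms by (auto simp: tour_subgraph_def subgraph_of_def)
  have "even (deg (mult T) x)" for x
  proof (cases "x \<in> verts T")
    case True then show ?thesis using ev degree_mult[OF sub] by simp
  next
    case False
    then have "{e \<in> edges T. x \<in> edge_ends e} = {}" using en by auto
    then have "degree T x = 0" by (simp only: degree_def card.empty)
    then show ?thesis using degree_mult[OF sub] by simp
  qed
  moreover have "(depot W, x) \<in> conn (mult T)"
    if "x \<in> picks W \<union> Field {p. mult T p \<noteq> 0}" for x
  proof -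
    have "x \<in> verts T"
    proof (cases "x \<in> picks W")
      case False
      then have "x \<in> Field {p. mult T p \<noteq> 0}" using that by blast
      then obtain u v where "mult T (u, v) \<noteq> 0" "x \<in> {u, v}" unfolding Field_def by blast
      then obtain c where "(u, v, c) \<in> edges T" "x \<in> {u, v}" using mult_nonzero by blast
      then show ?thesis using en[of "(u, v, c)"] by auto
    qed (use pv in blast)
    moreover have "depot W \<in> verts T" using rect pv by (auto simp: rectangular_warehouse_def)
    ultimately show ?thesis using con by (auto simp: connected_graph_def conn_mult)
  qed
  moreover have "mult T p \<le> 2" "mult T p \<noteq> 0 \<Longrightarrow> p \<in> links" for p
  proof -
    show "mult T p \<le> 2" by (simp add: mult_def card_bool_set)
    obtain u v where p: "p = (u, v)" by (cases p)
    show "p \<in> links" if "mult T p \<noteq> 0"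
      using that sub unfolding p mult_nonzero by (auto simp: graph_edges_def links_def)
  qed
  ultimately show ?thesis unfolding tour_mult_def by blast
qed

lemma picks_vertices: "picks W \<subseteq> vertices W" by (simp add: vertices_def)

lemma graph_of_edges: assumes "tour_mult f" shows "edges (graph_of f) \<subseteq> graph_edges W"
proof
  fix e assume e: "e \<in> edges (graph_of f)"
  obtain u v c where uvc: "e = (u, v, c)" by (cases e)
  then have "f (u, v) \<noteq> 0" using e by (simp add: graph_of_def split: if_splits)
  then have "(u, v) \<in> links" using tour_multD(2)[OF assms] by blast
  then show "e \<in> graph_edges W" using uvc unfolding graph_edges_def links_def by blast
qed

lemma tour_of_tour_mult:
  assumes "tour_mult f" shows "tour_subgraph W (graph_of f)"
proof -
  note mu = mult_graph_of[OF assms] and sub = graph_of_edges[OF assms]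
  have "x \<in> vertices W" if "x \<in> verts (graph_of f)" for x
  proof -
    have "x \<in> picks W \<or> (\<exists>y. f (x, y) \<noteq> 0 \<or> f (y, x) \<noteq> 0)"
      using that unfolding graph_of_def Field_def by auto
    then show ?thesis using picks_vertices link_vertices tour_multD(2)[OF assms] by blast
  qed
  moreover have "edge_ends e \<subseteq> verts (graph_of f)" if "e \<in> edges (graph_of f)" for e
  proof -
    obtain u v c where e: "e = (u, v, c)" by (cases e)
    then have "f (u, v) \<noteq> 0" using that by (simp add: graph_of_def split: if_splits)
    then have "(u, v) \<in> {p. f p \<noteq> 0}" by simp
    then have "u \<in> Field {p. f p \<noteq> 0}" "v \<in> Field {p. f p \<noteq> 0}"
      by (rule FieldI1, rule FieldI2)
    then show ?thesis using e by (simp add: graph_of_def)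
  qed
  moreover have "connected_graph (graph_of f)"
  proof -
    have "(depot W, x) \<in> conn f" if "x \<in> verts (graph_of f)" for x
      using that assms by (simp add: graph_of_def tour_mult_def)
    then have "(x, y) \<in> conn f" if "x \<in> verts (graph_of f)" "y \<in> verts (graph_of f)" for x y
      using that by (metis conn_sym conn_trans)
    then show ?thesis
      unfolding connected_graph_def conn_mult[symmetric] mu by blast
  qed
  moreover have "even (degree (graph_of f) x)" for x
    using assms degree_mult[OF sub] mu by (simp add: tour_mult_def)
  moreover have "picks W \<subseteq> verts (graph_of f)" by (simp add: graph_of_def)
  ultimately show ?thesis using sub unfolding tour_subgraph_def subgraph_of_def by blast
qed

lemma horizontal_link: "i \<in> {1..<m} \<Longrightarrow> j \<in> {1..n} \<Longrightarrow> (cr i j, cr (i + 1) j) \<in> links"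
  unfolding links_def horizontal_adj_def by blast

text \<open>
  The whole graph is a tour: each vertex is joined to the top of its aisle, and the tops are joined
  along the first cross-aisle. Hence a shortest tour exists.
\<close>
lemma all_double_tour: "tour_mult (\<lambda>p. if p \<in> links then 2 else 0)" (is "tour_mult ?f")
proof -
  have 1: "(cr 1 1, cr i 1) \<in> conn ?f" if "i \<in> {1..m}" for i
    using that
  proof (induction i)
    case (Suc i)
    show ?case
    proof (cases "i = 0")
      case False
      then have "(cr i 1, cr (Suc i) 1) \<in> links" using Suc horizontal_link[of i 1] n_ge by auto
      then have "(cr i 1, cr (Suc i) 1) \<in> conn ?f" by (intro conn_link) auto
      then show ?thesis using False Suc.IH Suc.prems by (auto intro: conn_trans)
    qed auto
  qed simp
  have 2: "(cr 1 1, x) \<in> conn ?f" if "x \<in> vertices W" for x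
  proof -
    obtain i y where x: "x = (i, y)" by (cases x)
    have b: "i \<in> {1..m}" "cp 1 \<le> y" using vertex_bounds[OF that] x by auto
    have "(i, cp 1) \<in> vertices W" using cr_in_vertices[of i 1] b n_ge by (simp add: crossing_def)
    then have "((i, cp 1), (i, y)) \<in> conn ?f"
      using aisle_part_links by (intro aisle_part_conn(1)) (use that x b in auto)
    then show ?thesis using 1[OF b(1)] x conn_trans by (auto simp: crossing_def)
  qed
  have "depot W \<in> vertices W" using rect by (auto simp: vertices_def rectangular_warehouse_def)
  moreover have "picks W \<union> Field {p. ?f p \<noteq> 0} \<subseteq> vertices W"
    using picks_vertices link_vertices by (auto simp: Field_def)
  ultimately have "(depot W, x) \<in> conn ?f" if "x \<in> picks W \<union> Field {p. ?f p \<noteq> 0}" for x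
    using 2 that by (meson conn_sym conn_trans subsetD)
  moreover have "even (deg ?f x)" for x
    unfolding deg_def by (intro dvd_sum) auto
  ultimately show ?thesis by (simp add: tour_mult_def)
qed

section \<open>Cuts\<close>

lemma tour_crosses_cut:
  assumes "tour_mult f" "depot W \<in> X" "q \<in> picks W" "q \<notin> X"
  shows "\<exists>u v. f (u, v) \<noteq> 0 \<and> (u \<in> X) \<noteq> (v \<in> X)"
proof (rule ccontr)
  assume "\<not> ?thesis"
  then have same: "(u \<in> X) = (v \<in> X)" if "f (u, v) \<noteq> 0" for u v using that by blast
  have "(depot W, q) \<in> conn f" using tour_multD(4) assms by blast
  then have "q \<in> X"
    unfolding conn_def by (induction rule: rtrancl_induct) (use assms(2) same in auto)
  then show False using assms by simp
qed

text \<open>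
  The degrees of the vertices in \<open>X\<close> add up to an even number. Links with both ends in \<open>X\<close> count
  twice, so the links that leave \<open>X\<close> have an even total multiplicity.
\<close>
lemma tour_cut_parity:
  assumes "tour_mult f" "finite X" "k \<in> links" "(fst k \<in> X) \<noteq> (snd k \<in> X)"
    and others: "\<And>u v. (u, v) \<in> links \<Longrightarrow> (u, v) \<noteq> k \<Longrightarrow> (u \<in> X) \<noteq> (v \<in> X) \<Longrightarrow> even (f (u, v))"
  shows "even (f k)"
proof -
  let ?w = "\<lambda>p. (of_bool (fst p \<in> X) + of_bool (snd p \<in> X) :: nat)"
  have w: "(\<Sum>x\<in>X. ends_at x p) = ?w p" for p
    using assms(2) by (simp add: ends_at_def sum.distrib sum_of_bool_eq)
  have "even (\<Sum>x\<in>X. deg f x)"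
    using tour_multD(3)[OF assms(1)] by (intro dvd_sum) auto
  also have "(\<Sum>x\<in>X. deg f x) = (\<Sum>p\<in>links. f p * ?w p)"
    unfolding deg_def by (subst sum.swap) (simp add: w flip: sum_distrib_left)
  also have "\<dots> = f k * ?w k + (\<Sum>p\<in>links - {k}. f p * ?w p)"
    by (rule sum.remove) (use assms finite_links in auto)
  finally have "even (f k * ?w k + (\<Sum>p\<in>links - {k}. f p * ?w p))" .
  moreover have "even (\<Sum>p\<in>links - {k}. f p * ?w p)"
  proof (rule dvd_sum)
    fix p assume p: "p \<in> links - {k}"
    show "even (f p * ?w p)"
    proof (cases "(fst p \<in> X) = (snd p \<in> X)")
      case False
      then show ?thesis using others[of "fst p" "snd p"] p by simp
    qed auto
  qed
  ultimately show ?thesis using assms(4) by (auto split: if_splits)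
qed

section \<open>Optimal multiplicities\<close>

definition doubles :: "(link \<Rightarrow> nat) \<Rightarrow> (nat \<times> nat) set" where
  "doubles f = {(i, j) \<in> boundary_subaisles W. \<forall>p\<in>segment i j (j + 1). f p = 2}"

text \<open>
  As no tour is shorter than \<open>f\<close>, the last clause ranges over the tours of least length.
\<close>
definition optimal :: "(link \<Rightarrow> nat) \<Rightarrow> bool" where
  "optimal f \<longleftrightarrow> tour_mult f \<and> (\<forall>g. tour_mult g \<longrightarrow> mult_length f \<le> mult_length g) \<and>
     (\<forall>g. tour_mult g \<longrightarrow> mult_length g \<le> mult_length f \<longrightarrow> card (doubles f) \<le> card (doubles g))"

lemma finite_doubles: "finite (doubles f)"
  by (rule finite_subset[of _ "boundary_subaisles W"]) (auto simp: doubles_def boundary_subaisles_def)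

lemma ex_optimal: "\<exists>f. optimal f"
proof -
  have "finite {f. \<forall>p. (p \<in> links \<longrightarrow> f p \<in> {..2}) \<and> (p \<notin> links \<longrightarrow> f p = (0::nat))}"
    by (rule finite_set_of_finite_funs) (auto simp: finite_links)
  then have fin: "finite (Collect tour_mult)"
    by (rule rev_finite_subset) (use tour_multD(1,2) in blast)
  let ?L = "Min (mult_length ` Collect tour_mult)"
  have "?L \<in> mult_length ` Collect tour_mult"
    by (intro Min_in) (use fin all_double_tour in auto)
  then obtain f0 where f0: "tour_mult f0 \<and> mult_length f0 = ?L" by auto
  have le: "?L \<le> mult_length g" if "tour_mult g" for g
    using fin that by (intro Min_le) auto
  obtain f where "tour_mult f \<and> mult_length f = ?L"
    and "\<And>g. tour_mult g \<and> mult_length g = ?L \<Longrightarrow> card (doubles f) \<le> card (doubles g)"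
    using ex_has_least_nat[of "\<lambda>f. tour_mult f \<and> mult_length f = ?L", OF f0, of "\<lambda>f. card (doubles f)"]
    by blast
  then have "optimal f" unfolding optimal_def using le by (metis order.antisym)
  then show ?thesis by blast
qed

section \<open>Segments and rungs\<close>

text \<open>
  Symmetric in the two aisles, like \<open>rung\<close>, so that left and right neighbours need no separate
  treatment.
\<close>
definition adjacent :: "nat \<Rightarrow> nat \<Rightarrow> bool" where
  "adjacent i i' \<longleftrightarrow> i \<in> {1..m} \<and> i' \<in> {1..m} \<and> (i' = i + 1 \<or> i = i' + 1)"

lemma adjacentD: "adjacent i i' \<Longrightarrow> i \<in> {1..m} \<and> i' \<in> {1..m} \<and> i \<noteq> i'"
  by (auto simp: adjacent_def)

lemma rung_commute: "rung i i' j = rung i' i j"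
  by (simp add: rung_def min.commute max.commute)

lemma rung_link: "adjacent i i' \<Longrightarrow> j \<in> {1..n} \<Longrightarrow> rung i i' j \<in> links"
  using horizontal_link[of i j] horizontal_link[of i' j]
  by (auto simp: adjacent_def rung_def min_def max_def)

lemma rung_length: "i \<noteq> i' \<Longrightarrow> link_length (rung i i' j) = aisle_dist W (min i i')"
  by (auto simp: rung_def link_length_def crossing_def min_def max_def)

lemma horizontal_rung:
  assumes "horizontal_adj W u v" "cr i j \<in> {u, v}" "j \<in> {1..n}"
  obtains i' where "adjacent i i'" "(u, v) = rung i i' j"
proof -
  obtain l j' where l: "l \<in> {1..<m}" "j' \<in> {1..n}" "u = cr l j'" "v = cr (l + 1) j'"
    using assms(1) unfolding horizontal_adj_def by blast
  have "j' = j \<and> (i = l \<or> i = l + 1)" using assms l by (auto simp: cr_eq_iff)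
  then consider "j' = j" "i = l" | "j' = j" "i = l + 1" by blast
  then show ?thesis
  proof cases
    case 1 then show ?thesis using l by (intro that[of "l + 1"]) (auto simp: adjacent_def rung_def)
  next
    case 2 then show ?thesis using l by (intro that[of l]) (auto simp: adjacent_def rung_def)
  qed
qed

lemma rung_conn: "f (rung i i' j) \<noteq> 0 \<Longrightarrow> (cr i j, cr i' j) \<in> conn f"
  by (cases "i \<le> i'") (auto simp: rung_def min_def max_def intro: conn_link conn_sym)

lemma segment_commute: "segment i a b = segment i b a"
  by (simp add: segment_def min.commute max.commute)

lemma segment_iff:
  assumes "a \<in> {1..n}" "b \<in> {1..n}"
  shows "(u, v) \<in> segment i a b \<longleftrightarrow>
    vertical_adj W u v \<and> fst u = i \<and> cp (min a b) \<le> snd u \<and> snd v \<le> cp (max a b)"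
proof -
  have "min (cp a) (cp b) = cp (min a b) \<and> max (cp a) (cp b) = cp (max a b)"
    using cp_le_iff[OF assms] by (auto simp: min_def max_def)
  then show ?thesis by (simp add: segment_def aisle_part_def)
qed

lemma segment_aisle: "(u, v) \<in> segment i a b \<Longrightarrow> fst u = i \<and> fst v = i \<and> vertical_adj W u v"
  by (auto simp: segment_def aisle_part_def vertical_adj_def)

lemma segment_links: "segment i a b \<subseteq> links"
  by (simp add: segment_def aisle_part_links)

lemma finite_segment: "finite (segment i a b)"
  by (rule finite_subset[OF segment_links finite_links])

lemma segment_eq_aisle_part:
  assumes "i \<in> {1..m}" "a \<in> {1..n}" "b \<in> {1..n}"
  obtains y z where "segment i a b = aisle_part i y z" "(i, y) \<in> vertices W" "(i, z) \<in> vertices W"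
    "y \<le> z" "{cr i a, cr i b} = {(i, y), (i, z)}" "z - y = \<bar>cp a - cp b\<bar>"
proof (cases "a \<le> b")
  case True
  then have "cp a \<le> cp b" using cp_le_iff assms by simp
  then show ?thesis using assms cr_in_vertices[of i]
    by (intro that[of "cp a" "cp b"]) (auto simp: segment_def crossing_def)
next
  case False
  then have "cp b \<le> cp a" using cp_le_iff assms by simp
  then show ?thesis using assms cr_in_vertices[of i]
    by (intro that[of "cp b" "cp a"]) (auto simp: segment_def crossing_def)
qed

lemma segment_length:
  assumes "i \<in> {1..m}" "a \<in> {1..n}" "b \<in> {1..n}"
  shows "(\<Sum>p\<in>segment i a b. link_length p) = \<bar>cp a - cp b\<bar>"
proof -
  obtain y z where yz: "segment i a b = aisle_part i y z" "(i, y) \<in> vertices W" "(i, z) \<in> vertices W"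
    "y \<le> z" "{cr i a, cr i b} = {(i, y), (i, z)}" "z - y = \<bar>cp a - cp b\<bar>"
    by (rule segment_eq_aisle_part[OF assms(1-3)])
  show ?thesis using aisle_part_length[OF yz(2-4)] yz(1,6) by simp
qed

lemma segment_parity:
  assumes "i \<in> {1..m}" "a \<in> {1..n}" "b \<in> {1..n}"
  shows "even ((\<Sum>p\<in>segment i a b. ends_at x p) + of_bool (x = cr i a) + of_bool (x = cr i b))"
proof -
  obtain y z where yz: "segment i a b = aisle_part i y z" "(i, y) \<in> vertices W" "(i, z) \<in> vertices W"
    "y \<le> z" "{cr i a, cr i b} = {(i, y), (i, z)}" "z - y = \<bar>cp a - cp b\<bar>"
    by (rule segment_eq_aisle_part[OF assms(1-3)])
  from yz(5) have "cr i a = (i, y) \<and> cr i b = (i, z) \<or> cr i a = (i, z) \<and> cr i b = (i, y)"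
    by (simp only: doubleton_eq_iff)
  then show ?thesis
    using aisle_part_parity[OF yz(2-4), of x] unfolding yz(1)
    by (elim disjE conjE) (simp_all only: add.assoc add.commute add.left_commute)
qed

lemma segment_conn:
  assumes "i \<in> {1..m}" "a \<in> {1..n}" "b \<in> {1..n}" and pos: "\<And>p. p \<in> segment i a b \<Longrightarrow> f p \<noteq> 0"
  shows "(cr i a, cr i b) \<in> conn f"
    and "(u, v) \<in> segment i a b \<Longrightarrow> (cr i a, u) \<in> conn f \<and> (cr i a, v) \<in> conn f"
proof -
  obtain y z where yz: "segment i a b = aisle_part i y z" "(i, y) \<in> vertices W" "(i, z) \<in> vertices W"
    "y \<le> z" "{cr i a, cr i b} = {(i, y), (i, z)}" "z - y = \<bar>cp a - cp b\<bar>"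
    by (rule segment_eq_aisle_part[OF assms(1-3)])
  have c: "((i, y), (i, z)) \<in> conn f"
    by (rule aisle_part_conn(1)[OF yz(2-4)]) (use pos yz(1) in auto)
  have a: "((i, y), cr i a) \<in> conn f" "((i, y), cr i b) \<in> conn f"
    using c yz(5) unfolding doubleton_eq_iff by (metis conn_refl)+
  then show "(cr i a, cr i b) \<in> conn f" by (rule conn_trans[OF conn_sym])
  assume "(u, v) \<in> segment i a b"
  then have "((i, y), u) \<in> conn f \<and> ((i, y), v) \<in> conn f"
    by (intro aisle_part_conn(2)[OF yz(2-4)]) (use pos yz(1) in auto)
  then show "(cr i a, u) \<in> conn f \<and> (cr i a, v) \<in> conn f"
    using conn_trans[OF conn_sym[OF a(1)]] by blast
qed

lemma segment_nonempty:
  assumes "i \<in> {1..m}" "a \<in> {1..n}" "b \<in> {1..n}" "a \<noteq> b"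
  shows "segment i a b \<noteq> {}"
proof
  assume "segment i a b = {}"
  then have "\<bar>cp a - cp b\<bar> = 0" using segment_length[OF assms(1-3)] by simp
  then show False using cp_eq_iff assms by simp
qed

lemma segment_mono:
  assumes "a \<in> {1..n}" "b \<in> {1..n}" "c \<in> {1..n}" "d \<in> {1..n}" "min a b \<le> min c d" "max c d \<le> max a b"
  shows "segment i c d \<subseteq> segment i a b"
proof -
  have "cp (min a b) \<le> cp (min c d)" "cp (max c d) \<le> cp (max a b)"
    using assms by (auto intro!: cp_le)
  then have "(u, v) \<in> segment i a b" if "(u, v) \<in> segment i c d" for u v
    using that segment_iff[OF assms(1,2)] segment_iff[OF assms(3,4)] by auto
  then show ?thesis by (rule subrelI)
qed

lemma rung_notin_segment: "i \<noteq> i' \<Longrightarrow> rung i i' j \<notin> segment l a b"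
  using segment_aisle[of "cr (min i i') j" "cr (max i i') j" l a b] by (auto simp: rung_def min_def)

lemma segment_disjoint: "i \<noteq> i' \<Longrightarrow> p \<in> segment i a b \<Longrightarrow> p \<notin> segment i' c d"
  using segment_aisle by (cases p) metis

lemma rung_eq_iff: "a \<in> {1..n} \<Longrightarrow> b \<in> {1..n} \<Longrightarrow> rung i i' a = rung i i' b \<longleftrightarrow> a = b"
  by (auto simp: rung_def cr_eq_iff)

lemma rung_ends: "ends_at x (rung i i' j) = of_bool (x = cr i j) + of_bool (x = cr i' j)"
  by (auto simp: rung_def ends_at_def min_def max_def)

lemma links_sum_restrict:
  fixes h :: "link \<Rightarrow> 'a :: comm_semiring_1"
  assumes "C \<subseteq> links"
  shows "(\<Sum>p\<in>links. of_bool (p \<in> C) * h p) = sum h C"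
proof -
  have "sum h C = sum h (links \<inter> C)" using assms by (simp add: Int_absorb1)
  also have "\<dots> = (\<Sum>p\<in>links. if p \<in> C then h p else 0)" by (rule sum.inter_restrict[OF finite_links])
  also have "\<dots> = (\<Sum>p\<in>links. of_bool (p \<in> C) * h p)" by (intro sum.cong) simp_all
  finally show ?thesis ..
qed

section \<open>The rectangle swap\<close>

text \<open>
  The symmetric difference with the rectangle between the levels \<open>a\<close> and \<open>b\<close>, as far as parity is
  concerned: every link of the rectangle changes its multiplicity by one. On the side of aisle \<open>i\<close>
  and the rung at \<open>a\<close> the change is downwards; on the other two sides it is upwards unless the link
  is already doubled.
\<close>
definition swap :: "(link \<Rightarrow> nat) \<Rightarrow> nat \<Rightarrow> nat \<Rightarrow> nat \<Rightarrow> nat \<Rightarrow> link \<Rightarrow> nat" where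
  "swap f i i' a b = (\<lambda>p.
     if p \<in> insert (rung i i' a) (segment i a b) then f p - 1
     else if p \<in> insert (rung i i' b) (segment i' a b) then (if f p = 2 then 1 else f p + 1)
     else f p)"

context
  fixes f i i' a b
  assumes tour: "tour_mult f" and adj: "adjacent i i'"
    and ab: "a \<in> {1..n}" "b \<in> {1..n}" "a \<noteq> b"
    and double: "\<And>p. p \<in> segment i a b \<Longrightarrow> f p = 2"
    and used: "f (rung i i' a) \<noteq> 0"
begin

lemma swap_left: "p \<in> segment i a b \<Longrightarrow> swap f i i' a b p = 1"
  using double by (simp add: swap_def)

lemma swap_right: "p \<in> segment i' a b \<Longrightarrow> swap f i i' a b p = (if f p = 2 then 1 else f p + 1)"
proof -
  assume p: "p \<in> segment i' a b"
  have "i \<noteq> i'" using adjacentD[OF adj] by simp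
  then have "p \<notin> segment i a b" "p \<noteq> rung i i' a"
    using p segment_disjoint rung_notin_segment by metis+
  then show ?thesis using p by (simp add: swap_def)
qed

lemma swap_rung_a: "swap f i i' a b (rung i i' a) = f (rung i i' a) - 1"
  by (simp add: swap_def)

lemma swap_rung_b:
  "swap f i i' a b (rung i i' b) = (if f (rung i i' b) = 2 then 1 else f (rung i i' b) + 1)"
  using ab adjacentD[OF adj] rung_notin_segment by (auto simp: swap_def rung_eq_iff)

lemma swap_other:
  "p \<notin> segment i a b \<Longrightarrow> p \<notin> segment i' a b \<Longrightarrow> p \<noteq> rung i i' a \<Longrightarrow> p \<noteq> rung i i' b \<Longrightarrow>
    swap f i i' a b p = f p"
  by (simp add: swap_def)

lemma swap_le: "swap f i i' a b p \<le> 2"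
  using tour_multD(1)[OF tour, of p] by (auto simp: swap_def)

lemma swap_link: "swap f i i' a b p \<noteq> 0 \<Longrightarrow> p \<in> links"
  using tour_multD(2)[OF tour, of p] segment_links rung_link[OF adj ab(1)] rung_link[OF adj ab(2)]
  by (auto simp: swap_def split: if_splits)

lemma cycle_disjoint:
  "insert (rung i i' a) (segment i a b) \<inter> insert (rung i i' b) (segment i' a b) = {}"
proof -
  have "i \<noteq> i'" using adjacentD[OF adj] by simp
  then show ?thesis using segment_disjoint[of i i'] rung_notin_segment[of i i'] rung_eq_iff ab by blast
qed

lemma cycle_links:
  "insert (rung i i' a) (segment i a b) \<subseteq> links" "insert (rung i i' b) (segment i' a b) \<subseteq> links"
  using segment_links rung_link[OF adj ab(1)] rung_link[OF adj ab(2)] by auto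

lemma swap_step:
  defines "A \<equiv> insert (rung i i' a) (segment i a b)" and "B \<equiv> insert (rung i i' b) (segment i' a b)"
  shows "real (swap f i i' a b p) \<le> real (f p) - of_bool (p \<in> A) + of_bool (p \<in> B)"
    and "even (swap f i i' a b p + f p + of_bool (p \<in> A \<union> B))"
proof -
  have g: "swap f i i' a b p = (if p \<in> A then f p - 1 else if p \<in> B then (if f p = 2 then 1 else f p + 1) else f p)"
    by (simp add: swap_def A_def B_def)
  have A: "f p \<noteq> 0" if "p \<in> A" using that double[of p] used by (auto simp: A_def)
  have AB: "p \<notin> B" if "p \<in> A" using that cycle_disjoint by (auto simp: A_def B_def)
  show "real (swap f i i' a b p) \<le> real (f p) - of_bool (p \<in> A) + of_bool (p \<in> B)"
    unfolding g using A AB by (cases "p \<in> A"; cases "p \<in> B") auto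
  show "even (swap f i i' a b p + f p + of_bool (p \<in> A \<union> B))"
    unfolding g using A AB by (cases "p \<in> A"; cases "p \<in> B") auto
qed

lemma swap_length: "mult_length (swap f i i' a b) \<le> mult_length f"
proof -
  define g where "g = swap f i i' a b"
  define A where "A = insert (rung i i' a) (segment i a b)"
  define B where "B = insert (rung i i' b) (segment i' a b)"
  have ii': "i \<in> {1..m}" "i' \<in> {1..m}" "i \<noteq> i'" using adjacentD[OF adj] by auto
  have S: "sum link_length A = sum link_length B"
    using rung_notin_segment[OF ii'(3)] finite_segment ii' ab
    by (simp add: A_def B_def segment_length rung_length)
  have "mult_length g \<le> (\<Sum>p\<in>links. real (f p) * link_length p
      - of_bool (p \<in> A) * link_length p + of_bool (p \<in> B) * link_length p)"
    unfolding mult_length_def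
  proof (rule sum_mono)
    fix p assume "p \<in> links"
    then have l: "link_length p > 0" by (rule link_length_pos)
    have "real (g p) * link_length p \<le> (real (f p) - of_bool (p \<in> A) + of_bool (p \<in> B)) * link_length p"
      using l swap_step(1)[of p] unfolding A_def B_def g_def by (intro mult_right_mono) simp_all
    then show "real (g p) * link_length p \<le> real (f p) * link_length p
        - of_bool (p \<in> A) * link_length p + of_bool (p \<in> B) * link_length p"
      by (simp only: distrib_right left_diff_distrib)
  qed
  also have "\<dots> = mult_length f - sum link_length A + sum link_length B"
    using cycle_links links_sum_restrict[of A link_length] links_sum_restrict[of B link_length]
    unfolding A_def B_def by (simp only: mult_length_def sum.distrib sum_subtractf)
  finally show ?thesis using S unfolding g_def by simp
qed

lemma swap_parity: "even (deg (swap f i i' a b) x)"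
proof -
  define g where "g = swap f i i' a b"
  define A where "A = insert (rung i i' a) (segment i a b)"
  define B where "B = insert (rung i i' b) (segment i' a b)"
  have ii': "i \<in> {1..m}" "i' \<in> {1..m}" "i \<noteq> i'" using adjacentD[OF adj] by auto
  have 1: "even (\<Sum>p\<in>links. (g p + f p + of_bool (p \<in> A \<union> B)) * ends_at x p)"
    unfolding A_def B_def g_def by (intro dvd_sum dvd_mult2 swap_step(2))
  have 2: "(\<Sum>p\<in>links. (g p + f p + of_bool (p \<in> A \<union> B)) * ends_at x p)
      = deg g x + deg f x + (\<Sum>p\<in>links. of_bool (p \<in> A \<union> B) * ends_at x p)"
    by (simp only: deg_def distrib_right sum.distrib)
  have 3: "even (\<Sum>p\<in>links. of_bool (p \<in> A \<union> B) * ends_at x p)"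
  proof -
    have "(\<Sum>p\<in>links. of_bool (p \<in> A \<union> B) * ends_at x p) = (\<Sum>p\<in>A \<union> B. ends_at x p)"
      using cycle_links by (intro links_sum_restrict) (simp add: A_def B_def)
    also have "(\<Sum>p\<in>A \<union> B. ends_at x p) = (\<Sum>p\<in>A. ends_at x p) + (\<Sum>p\<in>B. ends_at x p)"
      using cycle_disjoint finite_segment by (intro sum.union_disjoint) (simp_all add: A_def B_def)
    also have "(\<Sum>p\<in>A. ends_at x p) = (\<Sum>p\<in>segment i a b. ends_at x p) + (of_bool (x = cr i a) + of_bool (x = cr i' a))"
      unfolding A_def rung_ends[symmetric] using rung_notin_segment[OF ii'(3)] finite_segment by simp
    also have "(\<Sum>p\<in>B. ends_at x p) = (\<Sum>p\<in>segment i' a b. ends_at x p) + (of_bool (x = cr i b) + of_bool (x = cr i' b))"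
      unfolding B_def rung_ends[symmetric] using rung_notin_segment[OF ii'(3)] finite_segment by simp
    finally have eq: "(\<Sum>p\<in>links. of_bool (p \<in> A \<union> B) * ends_at x p) =
        ((\<Sum>p\<in>segment i a b. ends_at x p) + of_bool (x = cr i a) + of_bool (x = cr i b))
        + ((\<Sum>p\<in>segment i' a b. ends_at x p) + of_bool (x = cr i' a) + of_bool (x = cr i' b))"
      by (simp only: ac_simps)
    show ?thesis
      unfolding eq by (rule dvd_add[OF segment_parity[OF ii'(1) ab(1,2)] segment_parity[OF ii'(2) ab(1,2)]])
  qed
  have cancel: "even u \<Longrightarrow> even v \<Longrightarrow> even w \<Longrightarrow> u = d + v + w \<Longrightarrow> even d" for u v w d :: nat
    by simp
  show ?thesis using cancel[OF 1 tour_multD(3)[OF tour] 3 2] unfolding g_def .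
qed

text \<open>
  The three sides of the rectangle that avoid the rung at \<open>a\<close> join its ends.
\<close>
lemma swap_path:
  assumes g: "\<And>p. p \<in> segment i a b \<union> segment i' a b \<union> {rung i i' b} \<Longrightarrow> g p \<noteq> 0"
  shows "(cr i a, cr i' a) \<in> conn g"
proof -
  have ii': "i \<in> {1..m}" "i' \<in> {1..m}" using adjacentD[OF adj] by auto
  have 1: "(cr i a, cr i b) \<in> conn g" by (rule segment_conn(1)[OF ii'(1) ab(1,2)]) (rule g, simp)
  have 2: "(cr i' a, cr i' b) \<in> conn g"
    by (rule segment_conn(1)[OF ii'(2) ab(1,2)]) (rule g, simp)
  have 3: "(cr i b, cr i' b) \<in> conn g" by (rule rung_conn) (rule g, simp)
  show ?thesis by (rule conn_trans[OF conn_trans[OF 1 3] conn_sym[OF 2]])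
qed

lemma swap_nonzero: "p \<in> segment i a b \<union> segment i' a b \<union> {rung i i' b} \<Longrightarrow> swap f i i' a b p \<noteq> 0"
  using swap_left[of p] swap_right[of p] swap_rung_b by (auto split: if_splits)

text \<open>
  Only the rung at \<open>a\<close> can disappear in the swap, and the rest of the rectangle replaces it.
\<close>
lemma swap_conn:
  assumes "(s, t) \<in> conn f" shows "(s, t) \<in> conn (swap f i i' a b)"
proof (rule conn_map[where h = "\<lambda>x. x", OF assms])
  fix x y assume xy: "f (x, y) \<noteq> 0"
  show "(x, y) \<in> conn (swap f i i' a b)"
  proof (cases "(x, y) = rung i i' a")
    case False
    then have "swap f i i' a b (x, y) \<noteq> 0"
      using xy swap_nonzero[of "(x, y)"] swap_other[of "(x, y)"]
      by (cases "(x, y) \<in> segment i a b \<union> segment i' a b \<union> {rung i i' b}") simp_all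
    then show ?thesis by (rule conn_link)
  next
    case True
    then have "(x, y) = (cr i a, cr i' a) \<or> (x, y) = (cr i' a, cr i a)"
      by (auto simp: rung_def min_def max_def)
    moreover have c: "(cr i a, cr i' a) \<in> conn (swap f i i' a b)" by (rule swap_path[OF swap_nonzero])
    moreover note conn_sym[OF c]
    ultimately show ?thesis by (elim disjE) simp_all
  qed
qed

lemma swap_tour: "tour_mult (swap f i i' a b)"
proof -
  let ?g = "swap f i i' a b"
  have ii': "i \<in> {1..m}" "i' \<in> {1..m}" "i \<noteq> i'" using adjacentD[OF adj] by auto
  have "(cr i a, cr i' a) \<in> {p. f p \<noteq> 0} \<or> (cr i' a, cr i a) \<in> {p. f p \<noteq> 0}"
    using used by (simp add: rung_def min_def max_def split: if_splits)
  then have "cr i a \<in> Field {p. f p \<noteq> 0}" by (elim disjE) (rule FieldI1 FieldI2, assumption)+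
  then have da: "(depot W, cr i a) \<in> conn ?g" by (intro swap_conn tour_multD(4)[OF tour] UnI2)
  have a: "(cr i a, cr i' a) \<in> conn ?g" by (rule swap_path[OF swap_nonzero])
  \<comment> \<open>the links that the swap brings into use are joined to the corner \<open>cr i a\<close>, an old tour vertex\<close>
  have ends: "(cr i a, u) \<in> conn ?g \<and> (cr i a, v) \<in> conn ?g" if uv: "?g (u, v) \<noteq> 0" "f (u, v) = 0" for u v
  proof -
    have "(u, v) \<in> segment i' a b \<or> (u, v) = rung i i' b"
    proof (rule ccontr)
      assume n: "\<not> ?thesis"
      have "(u, v) \<notin> segment i a b" using double[of "(u, v)"] uv(2) by (metis zero_neq_numeral)
      moreover have "(u, v) \<noteq> rung i i' a" using used uv(2) by metis
      ultimately have "?g (u, v) = f (u, v)" using n by (intro swap_other) simp_all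
      then show False using uv by simp
    qed
    then show ?thesis
    proof
      assume "(u, v) \<in> segment i' a b"
      then have "(cr i' a, u) \<in> conn ?g \<and> (cr i' a, v) \<in> conn ?g"
        by (rule segment_conn(2)[OF ii'(2) ab(1,2), rotated]) (rule swap_nonzero, simp)
      then show ?thesis by (elim conjE) (intro conjI conn_trans[OF a])
    next
      assume r: "(u, v) = rung i i' b"
      have b: "(cr i a, cr i b) \<in> conn ?g"
        by (rule segment_conn(1)[OF ii'(1) ab(1,2)]) (rule swap_nonzero, simp)
      have "(cr i b, cr i' b) \<in> conn ?g" by (rule rung_conn) (rule swap_nonzero, simp)
      then have "(cr i a, cr i' b) \<in> conn ?g" by (rule conn_trans[OF b])
      moreover have "u \<in> {cr i b, cr i' b} \<and> v \<in> {cr i b, cr i' b}"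
        using r by (simp add: rung_def min_def max_def)
      ultimately show ?thesis using b by (elim conjE insertE emptyE) simp_all
    qed
  qed
  have "(depot W, x) \<in> conn ?g" if x: "x \<in> picks W \<union> Field {p. ?g p \<noteq> 0}" for x
  proof (cases "x \<in> picks W \<union> Field {p. f p \<noteq> 0}")
    case True
    then show ?thesis by (intro swap_conn tour_multD(4)[OF tour])
  next
    case False
    then obtain u v where uv: "?g (u, v) \<noteq> 0" "x = u \<or> x = v"
      using x unfolding Field_def by blast
    moreover have "f (u, v) = 0" using False uv unfolding Field_def by blast
    ultimately show ?thesis using ends conn_trans[OF da] by blast
  qed
  then show ?thesis unfolding tour_mult_def using swap_le swap_link swap_parity by blast
qed

end

text \<open>
  Outside aisle \<open>i'\<close> the swap creates no doubled subaisle, and it destroys the one at \<open>(i, J)\<close>. As the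
  number of doubled boundary subaisles cannot drop, a new one must appear in aisle \<open>i'\<close>; the last
  hypothesis, that the rectangle stays clear of any other boundary subaisle, leaves only
  \<open>(i', J)\<close> for it.
\<close>
lemma swap_optimal:
  assumes opt: "optimal f" and adj: "adjacent i i'"
    and ab: "a \<in> {1..n}" "b \<in> {1..n}" "a \<noteq> b"
    and double: "\<And>p. p \<in> segment i a b \<Longrightarrow> f p = 2"
    and used: "f (rung i i' a) \<noteq> 0"
    and J: "J \<in> {1, n - 1}" "min a b \<le> J" "J < max a b"
    and others: "\<And>j. j \<in> {1, n - 1} \<Longrightarrow> j \<noteq> J \<Longrightarrow> max a b \<le> j \<or> j + 1 \<le> min a b"
  shows "optimal (swap f i i' a b)" and "\<And>p. p \<in> segment i' J (J + 1) \<Longrightarrow> swap f i i' a b p = 2"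
proof -
  let ?g = "swap f i i' a b"
  have tour: "tour_mult f" using opt by (simp add: optimal_def)
  note sw = tour adj ab double used
  have ii': "i \<in> {1..m}" "i' \<in> {1..m}" "i \<noteq> i'" using adjacentD[OF adj] by auto
  have g: "tour_mult ?g" "mult_length ?g \<le> mult_length f"
    by (rule swap_tour[OF sw], simp_all) (rule swap_length[OF sw], simp_all)
  have rng: "j \<in> {1..n}" "j + 1 \<in> {1..n}" if "j \<in> {1, n - 1}" for j using that n_ge by auto
  have sub: "segment i J (J + 1) \<subseteq> segment i a b"
    using J by (intro segment_mono ab rng[OF J(1)]) auto
  have iJ: "(i, J) \<in> doubles f"
    using sub double ii' J(1) by (auto simp: doubles_def boundary_subaisles_def)
  have D: "doubles ?g \<subseteq> insert (i', J) (doubles f - {(i, J)})"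
  proof (clarify)
    fix l j assume lj: "(l, j) \<in> doubles ?g" and no: "(l, j) \<notin> doubles f - {(i, J)}"
    have lm: "l \<in> {1..m}" and j: "j \<in> {1, n - 1}" and g2: "\<And>p. p \<in> segment l j (j + 1) \<Longrightarrow> ?g p = 2"
      using lj by (auto simp: doubles_def boundary_subaisles_def)
    have notiJ: "(l, j) \<noteq> (i, J)"
    proof
      assume e: "(l, j) = (i, J)"
      obtain p where p: "p \<in> segment i J (J + 1)"
        using segment_nonempty[OF ii'(1) rng[OF J(1)]] by auto
      then have "?g p = 1" using sub swap_left[OF sw, of p] by auto
      then show False using g2[of p] p e by simp
    qed
    then have "(l, j) \<notin> doubles f" using no by blast
    then obtain p where p: "p \<in> segment l j (j + 1)" "f p \<noteq> 2"
      using lm j by (auto simp: doubles_def boundary_subaisles_def)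
    have "p \<notin> segment i a b" using g2[OF p(1)] swap_left[OF sw, of p] by auto
    moreover have "p \<noteq> rung i i' a" "p \<noteq> rung i i' b" using rung_notin_segment[OF ii'(3)] p(1) by auto
    moreover have "?g p \<noteq> f p" using g2[OF p(1)] p(2) by simp
    ultimately have p': "p \<in> segment i' a b" using swap_other[OF sw, of p] by blast
    then have "l = i'" using segment_disjoint p(1) by blast
    moreover have "j = J"
    proof (rule ccontr)
      assume "j \<noteq> J"
      then have o: "max a b \<le> j \<or> j + 1 \<le> min a b" using others j by blast
      obtain u v where uv: "p = (u, v)" by (cases p)
      have 1: "cp j \<le> snd u" "snd v \<le> cp (j + 1)" "snd u < snd v"
        using p(1) segment_iff[OF rng[OF j]] unfolding uv by (auto simp: vertical_adj_def)
      have 2: "cp (min a b) \<le> snd u" "snd v \<le> cp (max a b)"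
        using p' segment_iff[OF ab(1,2)] unfolding uv by auto
      show False using o
      proof
        assume "max a b \<le> j"
        then have "cp (max a b) \<le> cp j" using ab rng[OF j] by (intro cp_le) auto
        then show False using 1 2 by linarith
      next
        assume "j + 1 \<le> min a b"
        then have "cp (j + 1) \<le> cp (min a b)" using ab rng[OF j] by (intro cp_le) auto
        then show False using 1 2 by linarith
      qed
    qed
    ultimately show "l = i' \<and> j = J" by simp
  qed
  have cD: "card (doubles f - {(i, J)}) = card (doubles f) - 1" "card (doubles f) > 0"
    using iJ finite_doubles[of f] by (auto simp: card_gt_0_iff)
  have min: "card (doubles f) \<le> card (doubles ?g)" using opt g unfolding optimal_def by blast
  have in_g: "(i', J) \<in> doubles ?g"
  proof (rule ccontr)
    assume "\<not> ?thesis"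
    then have "doubles ?g \<subseteq> doubles f - {(i, J)}" using D by blast
    then have "card (doubles ?g) \<le> card (doubles f) - 1"
      using card_mono finite_doubles cD by (metis finite_Diff)
    then show False using min cD by linarith
  qed
  then show "\<And>p. p \<in> segment i' J (J + 1) \<Longrightarrow> ?g p = 2" by (auto simp: doubles_def)
  have "card (doubles ?g) \<le> card (insert (i', J) (doubles f - {(i, J)}))"
    using D finite_doubles by (intro card_mono) auto
  also have "\<dots> \<le> card (doubles f)" using cD finite_doubles[of f] by (simp add: card_insert_if)
  finally have "card (doubles ?g) \<le> card (doubles f)" .
  then show "optimal ?g" using opt g unfolding optimal_def by (meson order.trans)
qed

section \<open>Ends of doubled boundary subaisles\<close>

lemma optimal_tour: "optimal f \<Longrightarrow> tour_mult f"
  by (simp add: optimal_def)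

text \<open>
  Deleting both copies of a doubled link preserves all parities, so if it also kept the tour
  connected, there would be a shorter tour.
\<close>
lemma optimal_no_removal:
  assumes opt: "optimal f" and k: "f k = 2"
    and reach: "\<And>x. x \<in> picks W \<union> Field {p. (f(k := 0)) p \<noteq> 0} \<Longrightarrow> (depot W, x) \<in> conn (f(k := 0))"
  shows False
proof -
  note tour = optimal_tour[OF opt]
  let ?g = "f(k := 0)"
  have kl: "k \<in> links" using tour_multD(2)[OF tour] k by simp
  have "even (deg ?g x)" for x
  proof -
    have "deg f x = 2 * ends_at x k + deg ?g x"
      unfolding deg_def sum.remove[OF finite_links kl] by (simp add: k)
    then show ?thesis using tour_multD(3)[OF tour, of x] by simp
  qed
  moreover have "?g p \<le> 2" "?g p \<noteq> 0 \<Longrightarrow> p \<in> links" for p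
    using tour_multD(1,2)[OF tour, of p] by (cases "p = k"; simp)+
  moreover have "\<forall>x\<in>picks W \<union> Field {p. ?g p \<noteq> 0}. (depot W, x) \<in> conn ?g"
    by (intro ballI reach)
  ultimately have "tour_mult ?g" unfolding tour_mult_def by (intro conjI allI impI)
  then have "mult_length f \<le> mult_length ?g" using opt by (simp add: optimal_def)
  moreover have "mult_length f = 2 * link_length k + mult_length ?g"
    unfolding mult_length_def sum.remove[OF finite_links kl] by (simp add: k)
  ultimately show False using link_length_pos[OF kl] by simp
qed

text \<open>
  An extreme cross-aisle \<open>e\<close> and its only neighbour \<open>e'\<close>. With two cross-aisles, a subaisle is a boundary
  subaisle from both of its ends.
\<close>
definition end_levels :: "nat \<Rightarrow> nat \<Rightarrow> bool" where
  "end_levels e e' \<longleftrightarrow> e = 1 \<and> e' = 2 \<or> e = n \<and> e' = n - 1"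

lemma end_levelsD: "end_levels e e' \<Longrightarrow> e \<in> {1..n} \<and> e' \<in> {1..n} \<and> e \<noteq> e'"
  using n_ge by (auto simp: end_levels_def)

lemma end_levels_segment:
  assumes "end_levels e e'"
  shows "min e e' \<in> {1, n - 1}" and "segment i e e' = segment i (min e e') (min e e' + 1)"
proof -
  from assms consider "e = 1" "e' = 2" | "e = n" "e' = n - 1" unfolding end_levels_def by blast
  then have "min e e' \<in> {1, n - 1} \<and> segment i e e' = segment i (min e e') (min e e' + 1)"
  proof cases
    case 1
    have "min (1::nat) 2 = 1" "(1::nat) + 1 = 2" by auto
    then show ?thesis unfolding 1 by (simp add: numeral_2_eq_2)
  next
    case 2
    have "min n (n - 1) = n - 1" "n - 1 + 1 = n" using n_ge by auto
    then show ?thesis unfolding 2 using segment_commute[of i n "n - 1"] by simp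
  qed
  then show "min e e' \<in> {1, n - 1}" and "segment i e e' = segment i (min e e') (min e e' + 1)"
    by auto
qed

lemma swap_end:
  assumes opt: "optimal f" and adj: "adjacent i i'" and e: "end_levels e e'"
    and double: "\<And>p. p \<in> segment i e e' \<Longrightarrow> f p = 2" and used: "f (rung i i' e) \<noteq> 0"
  shows "optimal (swap f i i' e e')" and "\<And>p. p \<in> segment i' e e' \<Longrightarrow> swap f i i' e e' p = 2"
proof -
  note ee = end_levelsD[OF e]
  have J: "min e e' \<in> {1, n - 1}" "min e e' \<le> min e e'" "min e e' < max e e'"
    using end_levels_segment(1)[OF e] ee by auto
  have o: "max e e' \<le> j \<or> j + 1 \<le> min e e'" if "j \<in> {1, n - 1}" "j \<noteq> min e e'" for j
    using that e n_ge by (auto simp: end_levels_def min_def max_def)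
  note sw = swap_optimal[OF opt adj _ _ _ double used J o]
  show "optimal (swap f i i' e e')" using ee by (intro sw(1)) auto
  show "swap f i i' e e' p = 2" if "p \<in> segment i' e e'" for p
    using that ee unfolding end_levels_segment(2)[OF e] by (intro sw(2)) auto
qed

text \<open>
  The swap leaves one copy of the doubled rung, so all four sides of the rectangle are present
  afterwards. The side in aisle \<open>i'\<close> is doubled by optimality, and any of its links can be deleted,
  since the rest of the rectangle joins its ends.
\<close>
lemma no_double_rung_at_double_end:
  assumes opt: "optimal f" and adj: "adjacent i i'" and e: "end_levels e e'"
    and double: "\<And>p. p \<in> segment i e e' \<Longrightarrow> f p = 2" and rung2: "f (rung i i' e) = 2"
  shows False
proof -
  note ee = end_levelsD[OF e]
  have ii': "i \<in> {1..m}" "i' \<in> {1..m}" "i \<noteq> i'" using adjacentD[OF adj] by auto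
  have used: "f (rung i i' e) \<noteq> 0" using rung2 by simp
  define g where "g = swap f i i' e e'"
  have sw: "tour_mult f" "adjacent i i'" "e \<in> {1..n}" "e' \<in> {1..n}" "e \<noteq> e'"
    using optimal_tour[OF opt] adj ee by auto
  have gopt: "optimal g" and g2: "\<And>p. p \<in> segment i' e e' \<Longrightarrow> g p = 2"
    unfolding g_def by (rule swap_end[OF opt adj e double used], assumption)+
  have g1: "g p = 1" if "p \<in> segment i e e'" for p
    unfolding g_def by (rule swap_left[OF sw double used that])
  have ge: "g (rung i i' e) = 1"
    using swap_rung_a[OF sw double used] rung2 by (simp add: g_def)
  have ge': "g (rung i i' e') \<noteq> 0"
    using swap_rung_b[OF sw double used] by (simp add: g_def)
  obtain y z where yz: "segment i' e e' = aisle_part i' y z" "(i', y) \<in> vertices W" "(i', z) \<in> vertices W"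
    "y \<le> z" "{cr i' e, cr i' e'} = {(i', y), (i', z)}" "z - y = \<bar>cp e - cp e'\<bar>"
    by (rule segment_eq_aisle_part[OF ii'(2) sw(3,4)])
  obtain k where k: "k \<in> segment i' e e'" using segment_nonempty[OF ii'(2) sw(3-5)] by blast
  obtain u v where uv: "k = (u, v)" by (cases k)
  have adjuv: "vertical_adj W u v" and fu: "u = (i', snd u)" "v = (i', snd v)" and yu: "y \<le> snd u" "snd v \<le> z"
    using k unfolding uv yz(1) by (auto simp: aisle_part_def vertical_adj_def prod_eq_iff)
  have uvlt: "snd u < snd v" "u \<in> vertices W" "v \<in> vertices W" using adjuv by (auto simp: vertical_adj_def)
  define h where "h = g(k := 0)"
  \<comment> \<open>what remains of aisle \<open>i'\<close> on the two sides of the deleted link\<close>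
  have h_part: "h p \<noteq> 0" if "p \<in> aisle_part i' y (snd u) \<union> aisle_part i' (snd v) z" for p
  proof -
    have "p \<in> segment i' e e'" using that yu uvlt unfolding yz(1) by (auto simp: aisle_part_def)
    moreover have "p \<noteq> k" using that uvlt unfolding uv by (auto simp: aisle_part_def)
    ultimately show ?thesis using g2[of p] by (simp add: h_def)
  qed
  have hu: "((i', y), u) \<in> conn h"
    by (subst fu(1), rule aisle_part_conn(1)[OF yz(2) _ yu(1)]) (use fu uvlt h_part in auto)
  have hv: "(v, (i', z)) \<in> conn h"
    by (subst fu(2), rule aisle_part_conn(1)[OF _ yz(3) yu(2)]) (use fu uvlt h_part in auto)
  have knr: "k \<noteq> rung i i' j" for j using k rung_notin_segment[OF ii'(3)] by metis
  have kni: "p \<noteq> k" if "p \<in> segment i e e'" for p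
    using that k segment_disjoint[OF ii'(3)] by metis
  have c1: "(cr i e, cr i e') \<in> conn h"
    by (rule segment_conn(1)[OF ii'(1) sw(3,4)]) (simp add: h_def g1 kni)
  have c2: "(cr i e, cr i' e) \<in> conn h" "(cr i e', cr i' e') \<in> conn h"
    by (rule rung_conn, simp add: h_def ge ge' knr[symmetric])+
  \<comment> \<open>around the rectangle, through aisle \<open>i\<close>\<close>
  have c3: "(cr i' e, cr i' e') \<in> conn h"
    by (rule conn_trans[OF conn_sym[OF c2(1)] conn_trans[OF c1 c2(2)]])
  from yz(5) have "cr i' e = (i', y) \<and> cr i' e' = (i', z) \<or> cr i' e = (i', z) \<and> cr i' e' = (i', y)"
    by (simp only: doubleton_eq_iff)
  then have c4: "((i', y), (i', z)) \<in> conn h" using c3 conn_sym[OF c3] by (elim disjE conjE) simp_all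
  have cuv: "(u, v) \<in> conn h"
    by (rule conn_trans[OF conn_sym[OF hu] conn_trans[OF c4 conn_sym[OF hv]]])
  have all: "(s, t) \<in> conn h" if "(s, t) \<in> conn g" for s t
  proof (rule conn_map[where h = "\<lambda>x. x", OF that])
    fix x y assume "g (x, y) \<noteq> 0"
    then show "(x, y) \<in> conn h"
      using cuv uv by (cases "(x, y) = k") (auto intro!: conn_link simp: h_def)
  qed
  have "Field {p. h p \<noteq> 0} \<subseteq> Field {p. g p \<noteq> 0}"
    by (rule mono_Field) (auto simp: h_def)
  then have "(depot W, x) \<in> conn h" if "x \<in> picks W \<union> Field {p. h p \<noteq> 0}" for x
    using that by (intro all tour_multD(4)[OF optimal_tour[OF gopt]]) blast
  then show False
    using optimal_no_removal[OF gopt g2[OF k]] unfolding h_def by blast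
qed

lemma crossing_notin_interiors:
  assumes "j \<in> {1..n}" shows "cr i j \<notin> subaisle_interiors W"
proof
  assume "cr i j \<in> subaisle_interiors W"
  then obtain l where l: "l \<in> {1..<n}" "cp l < cp j" "cp j < cp (l + 1)"
    by (auto simp: subaisle_interiors_def crossing_def)
  then have "l < j" "j < l + 1" using cp_less_iff[of l j] cp_less_iff[of j "l + 1"] assms by auto
  then show False by simp
qed

text \<open>
  At an extreme cross-aisle an aisle continues in one direction only.
\<close>
lemma end_link:
  assumes "i \<in> {1..m}" and e: "end_levels e e'"
  shows "\<exists>k o'. k \<in> segment i e e' \<and> (k = (cr i e, o') \<or> k = (o', cr i e)) \<and> o' \<noteq> cr i e \<and>
    (\<forall>u v. vertical_adj W u v \<longrightarrow> u = cr i e \<or> v = cr i e \<longrightarrow> (u, v) = k)"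
proof -
  note ee = end_levelsD[OF e]
  have v: "(i, cp e) \<in> vertices W" "(i, cp e') \<in> vertices W"
    using cr_in_vertices[OF assms(1)] ee by (auto simp: crossing_def)
  from e consider "e = 1" "e' = 2" | "e = n" "e' = n - 1" unfolding end_levels_def by blast
  then show ?thesis
  proof cases
    case 1
    have "cp e < cp e'" using 1 n_ge by (intro cp_less) auto
    then obtain x where x: "cp e < x" "x \<le> cp e'" "vertical_adj W (i, cp e) (i, x)"
      using succ_vertex[OF v] by blast
    have "((i, cp e), (i, x)) \<in> segment i e e'"
      using x 1 ee segment_iff[of e e' "(i, cp e)" "(i, x)" i] by (simp add: numeral_2_eq_2)
    moreover have "(u, w) = ((i, cp e), (i, x))"
      if uw: "vertical_adj W u w" "u = cr i e \<or> w = cr i e" for u w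
    proof -
      have "cp e \<le> snd u" using uw(1) vertex_bounds(2)[of u] 1 by (auto simp: vertical_adj_def)
      then have u: "u = (i, cp e)" using uw by (auto simp: vertical_adj_def crossing_def)
      have w: "fst w = i" "cp e < snd w" "w \<in> vertices W" using uw(1) u by (auto simp: vertical_adj_def)
      have "\<not> snd w < x" using x(3) w by (auto simp: vertical_adj_def)
      moreover have "\<not> x < snd w" using x uw(1) u by (auto simp: vertical_adj_def)
      ultimately show ?thesis using u w by (simp add: prod_eq_iff)
    qed
    ultimately show ?thesis
      by (intro exI[of _ "((i, cp e), (i, x))"] exI[of _ "(i, x)"]) (use x(1) in \<open>auto simp: crossing_def\<close>)
  next
    case 2
    have "cp e' < cp e" using 2 n_ge by (auto intro: cp_less)
    then obtain x where x: "cp e' \<le> x" "x < cp e" "vertical_adj W (i, x) (i, cp e)"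
      using pred_vertex[OF v(2,1)] by blast
    have "((i, x), (i, cp e)) \<in> segment i e e'"
      using x 2 ee segment_iff[of e e' "(i, x)" "(i, cp e)" i] by (auto simp: min_def max_def)
    moreover have "(u, w) = ((i, x), (i, cp e))"
      if uw: "vertical_adj W u w" "u = cr i e \<or> w = cr i e" for u w
    proof -
      have "snd w \<le> cp e" using uw(1) vertex_bounds(3)[of w] 2 by (auto simp: vertical_adj_def)
      then have w: "w = (i, cp e)" using uw by (auto simp: vertical_adj_def crossing_def)
      have u: "fst u = i" "snd u < cp e" "u \<in> vertices W" using uw(1) w by (auto simp: vertical_adj_def)
      have "\<not> snd u > x" using x(3) u by (auto simp: vertical_adj_def)
      moreover have "\<not> x > snd u" using x uw(1) w u by (auto simp: vertical_adj_def)
      ultimately show ?thesis using u w by (simp add: prod_eq_iff)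
    qed
    ultimately show ?thesis
      by (intro exI[of _ "((i, x), (i, cp e))"] exI[of _ "(i, x)"]) (use x(2) in \<open>auto simp: crossing_def\<close>)
  qed
qed

text \<open>
  Without rungs the crossing hangs on a single doubled link \<open>k\<close>. A crossing other than the depot is no
  pick, so \<open>k\<close> can be deleted.
\<close>
lemma rung_at_double_end:
  assumes opt: "optimal f" and i: "i \<in> {1..m}" and e: "end_levels e e'"
    and double: "\<And>p. p \<in> segment i e e' \<Longrightarrow> f p = 2" and nd: "cr i e \<noteq> depot W"
  shows "\<exists>i'. adjacent i i' \<and> f (rung i i' e) \<noteq> 0"
proof (rule ccontr)
  assume none: "\<not> ?thesis"
  note ee = end_levelsD[OF e] and tour = optimal_tour[OF opt]
  obtain k o' where k: "k \<in> segment i e e'" "k = (cr i e, o') \<or> k = (o', cr i e)" "o' \<noteq> cr i e"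
    and only: "\<And>u v. vertical_adj W u v \<Longrightarrow> u = cr i e \<or> v = cr i e \<Longrightarrow> (u, v) = k"
    using end_link[OF i e] by blast
  have eN: "e \<in> {1..n}" using ee by simp
  have inc: "(u, v) = k" if "f (u, v) \<noteq> 0" "u = cr i e \<or> v = cr i e" for u v
  proof -
    have "(u, v) \<in> links" using that tour_multD(2)[OF tour] by blast
    then have "vertical_adj W u v \<or> horizontal_adj W u v" by (simp add: links_def)
    moreover have False if hor: "horizontal_adj W u v"
    proof -
      have "cr i e \<in> {u, v}" using \<open>u = cr i e \<or> v = cr i e\<close> by auto
      then obtain i' where "adjacent i i'" "(u, v) = rung i i' e"
        by (rule horizontal_rung[OF hor _ eN])
      then show False using none \<open>f (u, v) \<noteq> 0\<close> by metis
    qed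
    ultimately show ?thesis using only that(2) by blast
  qed
  define g where "g = f(k := 0)"
  \<comment> \<open>the retraction of the dead end onto its only neighbour\<close>
  define h where "h = (\<lambda>x. if x = cr i e then o' else x)"
  have g0: "u \<noteq> cr i e \<and> v \<noteq> cr i e" if "g (u, v) \<noteq> 0" for u v
  proof -
    have "f (u, v) \<noteq> 0" "(u, v) \<noteq> k" using that by (auto simp: g_def split: if_splits)
    then show ?thesis using inc by blast
  qed
  have conn: "(h s, h t) \<in> conn g" if "(s, t) \<in> conn f" for s t
  proof (rule conn_map[OF that])
    fix x y assume f: "f (x, y) \<noteq> 0"
    show "(h x, h y) \<in> conn g"
    proof (cases "(x, y) = k")
      case True
      then have "h x = o'" "h y = o'" using k(2,3) by (auto simp: h_def)
      then show ?thesis by simp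
    next
      case False
      then have "h x = x" "h y = y" "g (x, y) \<noteq> 0" using inc[OF f] f by (auto simp: h_def g_def)
      then show ?thesis by (simp add: conn_link)
    qed
  qed
  have "(depot W, x) \<in> conn g" if x: "x \<in> picks W \<union> Field {p. g p \<noteq> 0}" for x
  proof -
    have "x \<noteq> cr i e"
    proof (cases "x \<in> picks W")
      case True
      have "cr i e \<notin> subaisle_interiors W" using ee by (intro crossing_notin_interiors) auto
      then have "cr i e \<notin> picks W" using rect nd by (auto simp: rectangular_warehouse_def)
      then show ?thesis using True by blast
    next
      case False
      then obtain u v where "g (u, v) \<noteq> 0" "x = u \<or> x = v" using x unfolding Field_def by blast
      then show ?thesis using g0 by blast
    qed
    then have hx: "h x = x" "h (depot W) = depot W" using nd by (auto simp: h_def)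
    have "Field {p. g p \<noteq> 0} \<subseteq> Field {p. f p \<noteq> 0}" by (rule mono_Field) (auto simp: g_def)
    then have "x \<in> picks W \<union> Field {p. f p \<noteq> 0}" using x by blast
    then have "(depot W, x) \<in> conn f" by (rule tour_multD(4)[OF tour])
    from conn[OF this] show ?thesis unfolding hx .
  qed
  then show False using optimal_no_removal[OF opt double[OF k(1)]] unfolding g_def by blast
qed

text \<open>
  The vertical link at the crossing is doubled, so the rungs there have an even total multiplicity.
\<close>
lemma rung_parity_at_double_end:
  assumes tour: "tour_mult f" and adj: "adjacent i i'" and e: "end_levels e e'"
    and double: "\<And>p. p \<in> segment i e e' \<Longrightarrow> f p = 2" and odd: "odd (f (rung i i' e))"
  shows "\<exists>i''. adjacent i i'' \<and> i'' \<noteq> i' \<and> odd (f (rung i i'' e))"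
proof (rule ccontr)
  assume "\<not> ?thesis"
  then have none: "even (f (rung i i'' e))" if "adjacent i i''" "i'' \<noteq> i'" for i''
    using that by blast
  note ee = end_levelsD[OF e]
  have ii': "i \<in> {1..m}" "i \<noteq> i'" using adjacentD[OF adj] by auto
  obtain k o' where k: "k \<in> segment i e e'" "k = (cr i e, o') \<or> k = (o', cr i e)" "o' \<noteq> cr i e"
    and only: "\<And>u v. vertical_adj W u v \<Longrightarrow> u = cr i e \<or> v = cr i e \<Longrightarrow> (u, v) = k"
    using end_link[OF ii'(1) e] by blast
  have eN: "e \<in> {1..n}" using ee by simp
  have "even (f (rung i i' e))"
  proof (rule tour_cut_parity[OF tour, of "{cr i e}"])
    show "rung i i' e \<in> links" using adj ee by (intro rung_link) auto
    show "(fst (rung i i' e) \<in> {cr i e}) \<noteq> (snd (rung i i' e) \<in> {cr i e})"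
      using ii' ee by (auto simp: rung_def cr_eq_iff min_def max_def)
  next
    fix u v assume uv: "(u, v) \<in> links" "(u, v) \<noteq> rung i i' e" "(u \<in> {cr i e}) \<noteq> (v \<in> {cr i e})"
    show "even (f (u, v))"
    proof (cases "vertical_adj W u v")
      case True
      then have "(u, v) = k" using only uv(3) by blast
      then show ?thesis using double[OF k(1)] by simp
    next
      case False
      then have "horizontal_adj W u v" using uv(1) by (simp add: links_def)
      moreover have "cr i e \<in> {u, v}" using uv(3) by auto
      ultimately obtain i'' where "adjacent i i''" "(u, v) = rung i i'' e"
        by (rule horizontal_rung[OF _ _ eN])
      then show ?thesis using none[of i''] uv(2) by auto
    qed
  qed simp
  then show False using odd by simp
qed

text \<open>
  All rungs at the crossing are single and come in pairs by parity. A swap towards the side away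
  from the depot removes one rung, and at the crossing reached there the remaining possibilities
  contradict parity, \<open>no_double_rung_at_double_end\<close> or \<open>rung_at_double_end\<close>.
\<close>
lemma double_end_is_depot:
  assumes opt: "optimal f" and i: "i \<in> {1..m}" and e: "end_levels e e'"
    and double: "\<And>p. p \<in> segment i e e' \<Longrightarrow> f p = 2"
  shows "adjacent i i' \<Longrightarrow> f (rung i i' e) = 0" and "cr i e = depot W"
proof -
  note ee = end_levelsD[OF e] and tour = optimal_tour[OF opt]
  show no_rung: "f (rung i i' e) = 0" if adj: "adjacent i i'" for i'
  proof (rule ccontr)
    assume nz: "f (rung i i' e) \<noteq> 0"
    \<comment> \<open>no rung at such an end is doubled, so a rung in use is single\<close>
    have val: "f' (rung j j' e) = 1"
      if "optimal f'" "adjacent j j'" "\<And>p. p \<in> segment j e e' \<Longrightarrow> f' p = 2" "f' (rung j j' e) \<noteq> 0" for f' j j'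
    proof -
      have "f' (rung j j' e) \<noteq> 2" using no_double_rung_at_double_end[OF that(1,2) e that(3)] by blast
      then show ?thesis using that(4) tour_multD(1)[OF optimal_tour[OF that(1)], of "rung j j' e"] by linarith
    qed
    have v1: "f (rung i i' e) = 1" by (rule val[OF opt adj double nz])
    then have "odd (f (rung i i' e))" by simp
    then obtain i'' where i'': "adjacent i i''" "i'' \<noteq> i'" "odd (f (rung i i'' e))"
      using rung_parity_at_double_end[OF tour adj e double] by blast
    have nz'': "f (rung i i'' e) \<noteq> 0" using i''(3) by (metis even_zero)
    have v2: "f (rung i i'' e) = 1" by (rule val[OF opt i''(1) double nz''])
    have "cr i' e \<noteq> cr i'' e" using i''(2) by (simp add: crossing_def)
    \<comment> \<open>the depot occupies at most one of the two neighbouring crossings\<close>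
    then have "cr i' e \<noteq> depot W \<or> cr i'' e \<noteq> depot W" by metis
    then obtain l where l: "adjacent i l" "f (rung i l e) = 1" "cr l e \<noteq> depot W"
      using v1 v2 adj i''(1) by blast
    have used: "f (rung i l e) \<noteq> 0" using l(2) by simp
    define g where "g = swap f i l e e'"
    have gopt: "optimal g" and g2: "\<And>p. p \<in> segment l e e' \<Longrightarrow> g p = 2"
      unfolding g_def by (rule swap_end[OF opt l(1) e double used], assumption)+
    have g0: "g (rung l i e) = 0"
      using ee swap_rung_a[OF tour l(1) _ _ _ double used, of e'] l(2)
      by (simp add: g_def rung_commute[of l])
    have lm: "l \<in> {1..m}" using adjacentD[OF l(1)] by simp
    obtain q where q: "adjacent l q" "g (rung l q e) \<noteq> 0"
      using rung_at_double_end[OF gopt lm e g2 l(3)] by blast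
    have "odd (g (rung l q e))" using val[OF gopt q(1) g2 q(2)] by simp
    then obtain q' where q': "adjacent l q'" "q' \<noteq> q" "odd (g (rung l q' e))"
      using rung_parity_at_double_end[OF optimal_tour[OF gopt] q(1) e g2] by blast
    \<comment> \<open>aisle \<open>l\<close> has only two neighbours, and \<open>i\<close> is one of them\<close>
    have "q \<noteq> i" using q(2) g0 by (intro notI) simp
    moreover have "q' \<noteq> i" using q'(3) g0 by (intro notI) simp
    moreover have "q = l + 1 \<or> l = q + 1" "q' = l + 1 \<or> l = q' + 1" "l = i + 1 \<or> i = l + 1"
      using q(1) q'(1) l(1) by (simp_all add: adjacent_def)
    ultimately show False using q'(2) by linarith
  qed
  show "cr i e = depot W"
  proof (rule ccontr)
    assume "cr i e \<noteq> depot W"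
    then obtain i' where "adjacent i i'" "f (rung i i' e) \<noteq> 0"
      using rung_at_double_end[OF opt i e double] by blast
    then show False using no_rung[of i'] by simp
  qed
qed

section \<open>Optimal multiplicities double no boundary subaisle\<close>

lemma vertical_adj_unique:
  assumes "vertical_adj W u v" "vertical_adj W x y" "fst x = fst u" "snd x \<le> snd u" "snd u < snd y"
  shows "(x, y) = (u, v)"
proof -
  have between: "\<not> (snd s < snd z \<and> snd z < snd t)"
    if "vertical_adj W s t" "z \<in> vertices W" "fst z = fst s" for s t z
    using that unfolding vertical_adj_def by blast
  have v: "u \<in> vertices W" "v \<in> vertices W" "y \<in> vertices W" "fst v = fst u" "fst y = fst u" "snd u < snd v"
    using assms by (simp_all add: vertical_adj_def)
  have "snd x = snd u" using between[OF assms(2), of u] assms(3-5) v by simp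
  moreover have "snd y = snd v"
    using between[OF assms(2), of v] between[OF assms(1), of y] assms(3-5) v by simp
  ultimately show ?thesis using v assms(3) by (simp add: prod_eq_iff)
qed

text \<open>
  The vertices of aisle \<open>i\<close> on one side of the link \<open>(u, v)\<close> form a cut which only this link crosses,
  since no rung is in use there. Its multiplicity is therefore even, and it is not zero because there
  are picks inside and outside the cut. The flag \<open>low\<close> selects the side above (true) or below (false).
\<close>
lemma double_link_by_column_cut:
  assumes tour: "tour_mult f" and k: "vertical_adj W u v" "fst u = i"
    and X: "X = {x \<in> vertices W. fst x = i \<and> (snd x \<le> snd u) = low}"
    and depot: "depot W \<in> X" and q: "q \<in> picks W" "q \<notin> X"
    and rungs: "\<And>i' j. adjacent i i' \<Longrightarrow> j \<in> {1..n} \<Longrightarrow> (cp j \<le> snd u) = low \<Longrightarrow> f (rung i i' j) = 0"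
  shows "f (u, v) = 2"
proof -
  have uv: "u \<in> vertices W" "v \<in> vertices W" "fst v = i" "snd u < snd v"
    using k by (auto simp: vertical_adj_def)
  have cross: "(x, y) = (u, v)" if "f (x, y) \<noteq> 0" "(x \<in> X) \<noteq> (y \<in> X)" for x y
  proof -
    have "(x, y) \<in> links" using tour_multD(2)[OF tour] that(1) by blast
    then have xyv: "x \<in> vertices W" "y \<in> vertices W" and "vertical_adj W x y \<or> horizontal_adj W x y"
      using link_vertices[of x y] by (simp_all add: links_def)
    then show ?thesis
    proof (elim disjE)
      assume v: "vertical_adj W x y"
      then have xy: "fst x = fst y" "snd x < snd y" by (auto simp: vertical_adj_def)
      have "fst x = i \<and> (snd x \<le> snd u) \<noteq> (snd y \<le> snd u)"
      proof (cases "fst x = i")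
        case True
        then show ?thesis using that(2) xyv xy(1) unfolding X by simp blast
      next
        case False
        then show ?thesis using that(2) xy(1) unfolding X by simp
      qed
      then show ?thesis using xy k(2) by (intro vertical_adj_unique[OF k(1) v]) auto
    next
      assume h: "horizontal_adj W x y"
      then obtain l j where lj: "l \<in> {1..<m}" "j \<in> {1..n}" "x = cr l j" "y = cr (l + 1) j"
        unfolding horizontal_adj_def by blast
      have "x \<in> X \<or> y \<in> X" using that(2) by blast
      then have "(cp j \<le> snd u) = low \<and> cr i j \<in> {x, y}"
        by (rule disjE) (simp_all add: X lj)
      then have low: "(cp j \<le> snd u) = low" and "cr i j \<in> {x, y}" by blast+
      from this(2) obtain i' where "adjacent i i'" "(x, y) = rung i i' j"
        by (rule horizontal_rung[OF h _ lj(2)])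
      then show ?thesis using rungs[of i' j] that(1) lj(2) low by simp
    qed
  qed
  have "even (f (u, v))"
  proof (rule tour_cut_parity[OF tour, of X])
    show "finite X" using finite_vertices by (simp add: X)
    show "(u, v) \<in> links" using k by (simp add: links_def)
    show "(fst (u, v) \<in> X) \<noteq> (snd (u, v) \<in> X)" using uv k by (auto simp: X)
  next
    fix x y assume "(x, y) \<noteq> (u, v)" "(x \<in> X) \<noteq> (y \<in> X)"
    then have "f (x, y) = 0" using cross[of x y] by blast
    then show "even (f (x, y))" by simp
  qed
  moreover have "f (u, v) \<noteq> 0"
  proof -
    obtain x y where "f (x, y) \<noteq> 0" "(x \<in> X) \<noteq> (y \<in> X)" using tour_crosses_cut[OF tour depot q] by blast
    then show ?thesis using cross[of x y] by simp
  qed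
  moreover have "f (u, v) \<le> 2" by (rule tour_multD(1)[OF tour])
  ultimately show ?thesis by (cases "f (u, v) = 1") simp_all
qed

lemma optimal_no_doubles:
  assumes opt: "optimal f" and two: "card (nonempty_aisles W) \<ge> 2"
  shows "doubles f = {}"
proof (rule ccontr)
  assume "doubles f \<noteq> {}"
  then obtain i J where iJ: "(i, J) \<in> doubles f" by auto
  then have i: "i \<in> {1..m}" and J: "J \<in> {1, n - 1}" and J2: "\<And>p. p \<in> segment i J (J + 1) \<Longrightarrow> f p = 2"
    by (auto simp: doubles_def boundary_subaisles_def)
  note tour = optimal_tour[OF opt]
  obtain e e' where e: "end_levels e e'" and eJ: "e = 1 \<and> J = 1 \<or> e = n \<and> J = n - 1"
    and seg: "\<And>l. segment l e e' = segment l J (J + 1)"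
  proof (cases "J = 1")
    case True
    then show ?thesis by (intro that[of 1 2]) (auto simp: end_levels_def numeral_2_eq_2)
  next
    case False
    then have "J = n - 1" "n - 1 + 1 = n" using J n_ge by auto
    then show ?thesis using segment_commute[of _ n "n - 1"]
      by (intro that[of n "n - 1"]) (auto simp: end_levels_def)
  qed
  note ee = end_levelsD[OF e]
  have double: "f p = 2" if "p \<in> segment i e e'" for p using J2 that seg by simp
  have no_rung: "f (rung i i' e) = 0" if "adjacent i i'" for i'
    by (rule double_end_is_depot(1)[OF opt i e double that])
  have depot: "cr i e = depot W" by (rule double_end_is_depot(2)[OF opt i e double])
  obtain q where q: "q \<in> picks W" "fst q \<noteq> i"
  proof -
    have "\<not> nonempty_aisles W \<subseteq> {i}"
      using two card_mono[of "{i}" "nonempty_aisles W"] by auto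
    then show ?thesis using that by (auto simp: nonempty_aisles_def)
  qed
  define L where "L = {j \<in> {1..n}. \<exists>i'. adjacent i i' \<and> f (rung i i' j) \<noteq> 0}"
  have "L \<noteq> {}"
  proof -
    obtain u v where uv: "f (u, v) \<noteq> 0" "(u \<in> {x. fst x = i}) \<noteq> (v \<in> {x. fst x = i})"
      using tour_crosses_cut[OF tour, of "{x. fst x = i}" q] q depot[symmetric] by auto
    have "(u, v) \<in> links" using uv(1) tour_multD(2)[OF tour] by blast
    then have h: "horizontal_adj W u v" using uv(2) by (auto simp: links_def vertical_adj_def)
    then obtain l j where lj: "j \<in> {1..n}" "u = cr l j" "v = cr (l + 1) j"
      unfolding horizontal_adj_def by blast
    then have "cr i j \<in> {u, v}" using uv(2) by auto
    then obtain i' where "adjacent i i'" "(u, v) = rung i i' j"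
      by (rule horizontal_rung[OF h _ lj(1)])
    then show ?thesis using lj(1) uv(1) unfolding L_def by auto
  qed
  have finL: "finite L" by (simp add: L_def)
  have eL: "e \<notin> L" using no_rung by (auto simp: L_def)
  \<comment> \<open>the level in \<open>L\<close> nearest to \<open>e\<close>\<close>
  define j0 where "j0 = (if e = 1 then Min L else Max L)"
  have j0L: "j0 \<in> L" unfolding j0_def using Min_in[OF finL \<open>L \<noteq> {}\<close>] Max_in[OF finL \<open>L \<noteq> {}\<close>] by simp
  have first: "if e = 1 then j0 \<le> j else j \<le> j0" if "j \<in> L" for j
    unfolding j0_def using Min_le[OF finL that] Max_ge[OF finL that] by simp
  have j0: "j0 \<in> {1..n}" "j0 \<noteq> e" using j0L eL by (auto simp: L_def)
  obtain i' where adj: "adjacent i i'" and used: "f (rung i i' j0) \<noteq> 0" using j0L by (auto simp: L_def)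
  have long: "f p = 2" if "p \<in> segment i j0 e" for p
  proof -
    obtain u v where uv: "p = (u, v)" by (cases p)
    have k: "vertical_adj W u v" "fst u = i" "cp (min j0 e) \<le> snd u" "snd v \<le> cp (max j0 e)" "snd u < snd v"
      using that segment_iff[OF j0(1), of e] ee unfolding uv by (auto simp: vertical_adj_def)
    have ends: "if e = 1 then cp e \<le> snd u \<and> snd v \<le> cp j0 else cp j0 \<le> snd u \<and> snd v \<le> cp e"
      using k(3,4) j0 e n_ge by (auto simp: end_levels_def min_def max_def split: if_splits)
    have "f (u, v) = 2"
    proof (rule double_link_by_column_cut[OF tour k(1,2) refl, where low = "e = 1"])
      show "depot W \<in> {x \<in> vertices W. fst x = i \<and> (snd x \<le> snd u) = (e = 1)}"
        unfolding depot[symmetric] using ends k(5) cr_in_vertices[OF i, of e] ee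
        by (auto split: if_splits)
      show "q \<notin> {x \<in> vertices W. fst x = i \<and> (snd x \<le> snd u) = (e = 1)}" using q by simp
      show "q \<in> picks W" by (rule q)
    next
      fix i' j assume j: "adjacent i i'" "j \<in> {1..n}" "(cp j \<le> snd u) = (e = 1)"
      show "f (rung i i' j) = 0"
      proof (rule ccontr)
        assume "f (rung i i' j) \<noteq> 0"
        then have "j \<in> L" using j by (auto simp: L_def)
        then have f1: "if e = 1 then j0 \<le> j else j \<le> j0" by (rule first)
        show False
        proof (cases "e = 1")
          case True
          then have "cp j0 \<le> cp j" using f1 cp_le_iff[OF j0(1) j(2)] by simp
          then show False using True ends j(3) k(5) by auto
        next
          case False
          then have "cp j \<le> cp j0" using f1 cp_le_iff[OF j(2) j0(1)] by simp
          then show False using False ends j(3) by auto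
        qed
      qed
    qed
    then show ?thesis by (simp add: uv)
  qed
  \<comment> \<open>\<open>n + 1 - e\<close> is the extreme level opposite to \<open>e\<close>, and \<open>d\<close> its neighbour\<close>
  have not_opposite: "j0 \<noteq> n + 1 - e"
  proof
    assume opp: "j0 = n + 1 - e"
    define d where "d = (if e = 1 then n - 1 else 2)"
    have d: "end_levels j0 d" "d \<in> {1..n}" using opp e n_ge by (auto simp: end_levels_def d_def)
    have "segment i j0 d \<subseteq> segment i j0 e"
      using j0 ee d opp e n_ge by (intro segment_mono) (auto simp: end_levels_def d_def)
    then have "cr i j0 = depot W"
      using long by (intro double_end_is_depot(2)[OF opt i d(1)]) blast
    then show False using depot j0 ee cr_eq_iff[of j0 e i i] by simp
  qed
  have J': "min j0 e \<le> J" "J < max j0 e"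
    using eJ j0 n_ge by (auto simp: min_def max_def)
  have other: "max j0 e \<le> j \<or> j + 1 \<le> min j0 e" if "j \<in> {1, n - 1}" "j \<noteq> J" for j
    using that eJ not_opposite j0 n_ge by (auto simp: min_def max_def)
  have eN: "e \<in> {1..n}" using ee by simp
  define g where "g = swap f i i' j0 e"
  have gopt: "optimal g" and g2: "\<And>p. p \<in> segment i' J (J + 1) \<Longrightarrow> g p = 2"
    unfolding g_def by (rule swap_optimal[OF opt adj j0(1) eN j0(2) long used J J' other], assumption+)+
  have "cr i' e = depot W"
    using adjacentD[OF adj] g2 seg by (intro double_end_is_depot(2)[OF gopt _ e]) auto
  then have "cr i' e = cr i e" unfolding depot .
  then show False using adjacentD[OF adj] by (simp add: crossing_def)
qed

lemma minimal_tour_graph_of: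
  assumes "optimal f" shows "minimal_tour W (graph_of f)"
proof -
  note tour = optimal_tour[OF assms]
  have "tour_length W (graph_of f) \<le> tour_length W T" if T: "tour_subgraph W T" for T
  proof -
    have "edges T \<subseteq> graph_edges W" using T by (simp add: tour_subgraph_def subgraph_of_def)
    then have "tour_length W T = mult_length (mult T)" by (rule tour_length_mult)
    moreover have "tour_length W (graph_of f) = mult_length f"
      using tour_length_mult[OF graph_of_edges[OF tour]] mult_graph_of[OF tour] by simp
    moreover have "mult_length f \<le> mult_length (mult T)"
      using assms tour_mult_of_tour[OF T] by (simp add: optimal_def)
    ultimately show ?thesis by simp
  qed
  then show ?thesis using tour_of_tour_mult[OF tour] by (simp add: minimal_tour_def)
qed

lemma double_edge_in_iff:
  assumes "tour_mult f" "j \<in> {1..<n}"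
  shows "double_edge_in W (graph_of f) i j \<longleftrightarrow> (\<forall>p\<in>segment i j (j + 1). f p = 2)"
proof -
  have r: "j \<in> {1..n}" "j + 1 \<in> {1..n}" using assms(2) by auto
  have "(\<forall>c. (u, v, c) \<in> edges (graph_of f)) \<longleftrightarrow> f (u, v) = 2" for u v
    using tour_multD(1)[OF assms(1), of "(u, v)"] by (auto simp: graph_of_def all_bool_eq)
  moreover have "(u, v) \<in> segment i j (j + 1) \<longleftrightarrow>
      vertical_adj W u v \<and> fst u = i \<and> cp j \<le> snd u \<and> snd v \<le> cp (j + 1)" for u v
    using segment_iff[OF r, of u v i] by (simp add: min_def max_def)
  ultimately show ?thesis unfolding double_edge_in_def by (metis surj_pair)
qed

end

theorem theorem2:
  fixes W :: warehouse
  assumes "rectangular_warehouse W"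
    and "card (nonempty_aisles W) \<ge> 2"
  shows "\<exists>T. minimal_tour W T \<and> (\<forall>(i, j)\<in>boundary_subaisles W. \<not> double_edge_in W T i j)"
proof -
  interpret warehouse_graph W by unfold_locales (rule assms(1))
  obtain f where opt: "optimal f" using ex_optimal by blast
  have "\<not> double_edge_in W (graph_of f) i j" if ij: "(i, j) \<in> boundary_subaisles W" for i j
  proof -
    have "j \<in> {1..<num_cross W}" using ij n_ge by (auto simp: boundary_subaisles_def)
    moreover have "(i, j) \<notin> doubles f" using optimal_no_doubles[OF opt assms(2)] by simp
    ultimately show ?thesis
      using ij by (simp add: double_edge_in_iff[OF optimal_tour[OF opt]] doubles_def)
  qed
  then show ?thesis using minimal_tour_graph_of[OF opt] by blast
qed

end
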